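(* Let $\Omega=[0,\pi]^2$ and let $\mathcal T_h$ be uniform with mesh size $h$. Let $\lambda_k=m^2+n^2$ with positive integers $m,n$ be an eigenvalue of the Dirichlet Laplacian on $\Omega$. Then there exists an eigenvalue $\lambda_h^{m,n}$ of the discrete mixed eigenvalue problem such that, as $h\to0$, $$\lambda_h^{m,n}-\lambda_k=\frac{(m^4+n^4)h^2}{12}+O(h^4).$$
   Context: Uniform mesh: $\mathcal T_h$ is the partition of $[0,\pi]^2$ into congruent axis-parallel squares of side $h$ (i.e. $h_{x_i}\equiv h\equiv h_{y_j}$). $(\cdot,\cdot)$ is the $L^2(\Omega)$ inner product. With $Q_{mn}=\operatorname{span}\{x^iy^j:0\le i\le m,0\le j\le n\}$, $\boldsymbol\Sigma_h=\{\boldsymbol\tau_h\in\boldsymbol H(\operatorname{div},\Omega):\boldsymbol\tau_h|_K\in Q_{10}(K)\times Q_{01}(K)\ \forall K\in\mathcal T_h\}$ and $V_h=\{v_h\in L^2(\Omega): v_h|_K \text{ constant }\forall K\in\mathcal T_h\}$ (lowest-order rectangular Raviart-Thomas element). Discrete mixed eigenvalue problem: find $(\lambda_h,\boldsymbol\sigma_h,u_h)\in\mathbb R\times\boldsymbol\Sigma_h\times V_h$, $u_h\neq0$, with $(\boldsymbol\sigma_h,\boldsymbol\tau_h)-(\operatorname{div}\boldsymbol\tau_h,u_h)=0$ and $(\operatorname{div}\boldsymbol\sigma_h,v_h)=\lambda_h(u_h,v_h)$ for all $(\boldsymbol\tau_h,v_h)\in\boldsymbol\Sigma_h\times V_h$.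 The constant in $O(h^4)$ is independent of $h$ for fixed $(m,n)$. *)

theory Defs
  imports "HOL-Analysis.Analysis" "HOL-Library.Landau_Symbols"
begin

text \<open>Elements of \<open>L\<^sup>2(S)\<close> are represented by functions; equality of such elements is
  equality almost everywhere on \<open>S\<close>, and no representative is singled out.\<close>

definition L2_space :: "'a::euclidean_space set \<Rightarrow> ('a \<Rightarrow> 'b::euclidean_space) set" where
  "L2_space S = {f \<in> borel_measurable (lebesgue_on S).
     integrable (lebesgue_on S) (\<lambda>x. (norm (f x))\<^sup>2)}"

definition L2_inner ::
    "'a::euclidean_space set \<Rightarrow> ('a \<Rightarrow> 'b::euclidean_space) \<Rightarrow> ('a \<Rightarrow> 'b) \<Rightarrow> real" where
  "L2_inner S f g = (\<integral>x. f x \<bullet> g x \<partial>lebesgue_on S)"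

text \<open>For differentiable \<open>f\<close> and \<open>b \<in> Basis\<close>, \<open>partial_deriv b f\<close> is the partial derivative
  of \<open>f\<close> in the coordinate direction \<open>b\<close>.\<close>

definition partial_deriv ::
    "'a::euclidean_space \<Rightarrow> ('a \<Rightarrow> real) \<Rightarrow> 'a \<Rightarrow> real" where
  "partial_deriv b f x = frechet_derivative f (at x) b"

definition grad :: "('a::euclidean_space \<Rightarrow> real) \<Rightarrow> 'a \<Rightarrow> 'a" where
  "grad f x = (\<Sum>b\<in>Basis. partial_deriv b f x *\<^sub>R b)"

definition laplacian :: "('a::euclidean_space \<Rightarrow> real) \<Rightarrow> 'a \<Rightarrow> real" where
  "laplacian f x = (\<Sum>b\<in>Basis. partial_deriv b (partial_deriv b f) x)"

text \<open>\<open>Ck_on k S f\<close> is \<open>f \<in> C\<^sup>k(S)\<close>; it is meant for open \<open>S\<close>.\<close>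

primrec Ck_on :: "nat \<Rightarrow> 'a::euclidean_space set \<Rightarrow> ('a \<Rightarrow> real) \<Rightarrow> bool" where
  "Ck_on 0 S f \<longleftrightarrow> continuous_on S f"
| "Ck_on (Suc k) S f \<longleftrightarrow>
     (\<forall>x\<in>S. f differentiable (at x)) \<and> (\<forall>b\<in>Basis. Ck_on k S (partial_deriv b f))"

definition test_functions :: "'a::euclidean_space set \<Rightarrow> ('a \<Rightarrow> real) set" where
  "test_functions S = {\<phi>. (\<forall>k. Ck_on k UNIV \<phi>) \<and>
     compact (closure {x. \<phi> x \<noteq> 0}) \<and> closure {x. \<phi> x \<noteq> 0} \<subseteq> S}"

text \<open>Distributional divergence. Test functions live on the interior, so that a closed domain
  may be used for \<open>S\<close>.\<close>

definition has_weak_divergence ::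
    "'a::euclidean_space set \<Rightarrow> ('a \<Rightarrow> 'a) \<Rightarrow> ('a \<Rightarrow> real) \<Rightarrow> bool" where
  "has_weak_divergence S \<tau> g \<longleftrightarrow>
     (\<forall>\<phi>\<in>test_functions (interior S). L2_inner S \<tau> (grad \<phi>) = - L2_inner S g \<phi>)"

definition Hdiv :: "'a::euclidean_space set \<Rightarrow> ('a \<Rightarrow> 'a) set" where
  "Hdiv S = {\<tau> \<in> L2_space S. \<exists>g\<in>L2_space S. has_weak_divergence S \<tau> g}"

text \<open>For \<open>\<tau> \<in> Hdiv S\<close> the divergence is determined up to a null set of the domain;
  the choice of a representative does not affect its \<open>L\<^sup>2\<close> inner products.\<close>

definition divergence :: "'a::euclidean_space set \<Rightarrow> ('a \<Rightarrow> 'a) \<Rightarrow> 'a \<Rightarrow> real" where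
  "divergence S \<tau> = (SOME g. g \<in> L2_space S \<and> has_weak_divergence S \<tau> g)"

text \<open>Classical eigenvalues: on the square, all Dirichlet eigenfunctions are smooth inside and
  continuous up to the boundary.\<close>

definition dirichlet_eigenvalue :: "'a::euclidean_space set \<Rightarrow> real \<Rightarrow> bool" where
  "dirichlet_eigenvalue S lam \<longleftrightarrow>
     (\<exists>u. continuous_on (closure S) u \<and> Ck_on 2 (interior S) u \<and>
        (\<exists>x\<in>interior S. u x \<noteq> 0) \<and>
        (\<forall>x\<in>frontier S. u x = 0) \<and>
        (\<forall>x\<in>interior S. - laplacian u x = lam * u x))"

definition Omega :: "(real \<times> real) set" where
  "Omega = {0..pi} \<times> {0..pi}"

definition mesh_sizes :: "real set" where
  "mesh_sizes = {h. h > 0 \<and> (\<exists>N::nat. real N * h = pi)}"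

definition uniform_mesh :: "real \<Rightarrow> (real \<times> real) set set" where
  "uniform_mesh h =
     {{real i * h .. real (i + 1) * h} \<times> {real j * h .. real (j + 1) * h} | i j :: nat.
        real (i + 1) * h \<le> pi \<and> real (j + 1) * h \<le> pi}"

definition Q_poly :: "nat \<Rightarrow> nat \<Rightarrow> (real \<times> real \<Rightarrow> real) set" where
  "Q_poly m n = {p. \<exists>c :: nat \<Rightarrow> nat \<Rightarrow> real.
     \<forall>x y. p (x, y) = (\<Sum>i\<le>m. \<Sum>j\<le>n. c i j * x ^ i * y ^ j)}"

definition Sigma_h :: "real \<Rightarrow> (real \<times> real \<Rightarrow> real \<times> real) set" where
  "Sigma_h h = {\<tau> \<in> Hdiv Omega. \<forall>K\<in>uniform_mesh h.
     \<exists>p\<in>Q_poly 1 0. \<exists>q\<in>Q_poly 0 1. AE x in lebesgue_on K. \<tau> x = (p x, q x)}"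

definition V_h :: "real \<Rightarrow> (real \<times> real \<Rightarrow> real) set" where
  "V_h h = {v \<in> L2_space Omega. \<forall>K\<in>uniform_mesh h. \<exists>c. AE x in lebesgue_on K. v x = c}"

definition discrete_mixed_eigenvalue :: "real \<Rightarrow> real \<Rightarrow> bool" where
  "discrete_mixed_eigenvalue h lam \<longleftrightarrow>
     (\<exists>\<sigma>\<in>Sigma_h h. \<exists>u\<in>V_h h.
        \<not> (AE x in lebesgue_on Omega. u x = 0) \<and>
        (\<forall>\<tau>\<in>Sigma_h h. L2_inner Omega \<sigma> \<tau> - L2_inner Omega (divergence Omega \<tau>) u = 0) \<and>
        (\<forall>v\<in>V_h h. L2_inner Omega (divergence Omega \<sigma>) v = lam * L2_inner Omega u v))"

lemma mesh_sizes_accumulate: "at 0 within mesh_sizes \<noteq> bot"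
proof -
  have "(\<lambda>n. pi / real (Suc n)) \<longlonglongrightarrow> 0"
    by (rule LIMSEQ_Suc) (rule lim_const_over_n)
  moreover have "pi / real (Suc n) \<in> mesh_sizes - {0}" for n
    by (auto simp: mesh_sizes_def intro!: exI[of _ "Suc n"] simp del: of_nat_Suc)
  ultimately have "0 islimpt mesh_sizes"
    unfolding islimpt_sequential by (intro exI[of _ "\<lambda>n. pi / real (Suc n)"] conjI allI)
  then show ?thesis by (simp add: trivial_limit_within)
qed

lemma dirichlet_eigenvalue_Omega:
  fixes m n :: nat
  assumes "m > 0" "n > 0"
  shows "dirichlet_eigenvalue Omega (real m ^ 2 + real n ^ 2)"
proof -
  define u where "u = (\<lambda>z::real\<times>real. sin (m * fst z) * sin (n * snd z))"
  define ux where "ux = (\<lambda>z::real\<times>real. m * cos (m * fst z) * sin (n * snd z))"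
  define uy where "uy = (\<lambda>z::real\<times>real. n * sin (m * fst z) * cos (n * snd z))"
  define uxy where "uxy = (\<lambda>z::real\<times>real. m * n * cos (m * fst z) * cos (n * snd z))"
  have du: "(u has_derivative (\<lambda>d. fst d * ux z + snd d * uy z)) (at z)" for z
    unfolding u_def ux_def uy_def
    by (auto intro!: derivative_eq_intros simp: algebra_simps)
  have dux: "(ux has_derivative (\<lambda>d. fst d * (- (real m)\<^sup>2 * u z) + snd d * uxy z)) (at z)" for z
    unfolding u_def ux_def uxy_def
    by (auto intro!: derivative_eq_intros simp: algebra_simps power2_eq_square)
  have duy: "(uy has_derivative (\<lambda>d. fst d * uxy z + snd d * (- (real n)\<^sup>2 * u z))) (at z)" for z
    unfolding u_def uy_def uxy_def
    by (auto intro!: derivative_eq_intros simp: algebra_simps power2_eq_square)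
  have B: "(Basis :: (real\<times>real) set) = {(1,0),(0,1)}"
    by (auto simp: Basis_prod_def)
  have pu: "partial_deriv (1,0) u = ux" "partial_deriv (0,1) u = uy"
    by (auto simp: partial_deriv_def fun_eq_iff frechet_derivative_at[OF du, symmetric])
  have puu: "partial_deriv (1,0) ux = (\<lambda>z. - (real m)\<^sup>2 * u z)" "partial_deriv (0,1) ux = uxy"
    "partial_deriv (1,0) uy = uxy" "partial_deriv (0,1) uy = (\<lambda>z. - (real n)\<^sup>2 * u z)"
    by (auto simp: partial_deriv_def fun_eq_iff frechet_derivative_at[OF dux, symmetric]
        frechet_derivative_at[OF duy, symmetric])
  have cu: "continuous_on A u" "continuous_on A uxy" for A
    unfolding u_def uxy_def by (auto intro!: continuous_intros)
  have "u differentiable at z" "ux differentiable at z" "uy differentiable at z" for z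
    using du[of z] dux[of z] duy[of z] unfolding differentiable_def by blast+
  then have C2: "Ck_on 2 (interior Omega) u"
    by (auto simp: numeral_2_eq_2 B pu puu intro!: continuous_intros cu)
  have lap: "- laplacian u z = (real m ^ 2 + real n ^ 2) * u z" for z
    by (simp add: laplacian_def B pu puu algebra_simps)
  have int: "interior Omega = {0<..<pi} \<times> {0<..<pi}" and cl: "closure Omega = Omega"
    by (simp_all add: Omega_def interior_Times closure_Times)
  have s: "sin (real k * pi) = 0" for k by (rule sin_npi)
  have bd: "u z = 0" if "z \<in> frontier Omega" for z
  proof -
    have "z \<in> {0..pi} \<times> {0..pi}" "z \<notin> {0<..<pi} \<times> {0<..<pi}"
      using that unfolding frontier_def int cl by (auto simp: Omega_def)
    then have "fst z = 0 \<or> fst z = pi \<or> snd z = 0 \<or> snd z = pi"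
      by (auto simp: mem_Times_iff)
    then show ?thesis by (auto simp: u_def s)
  qed
  define z where "z = (pi / (2 * m), pi / (2 * n))"
  have h: "0 < pi / (2 * real k)" "pi / (2 * real k) < pi" "real k * (pi / (2 * real k)) = pi / 2"
    if "k > 0" for k
    using that by (auto simp: divide_simps)
  have "z \<in> interior Omega" "u z \<noteq> 0"
    using h[OF assms(1)] h[OF assms(2)] assms by (auto simp: z_def int u_def)
  then show ?thesis
    unfolding dirichlet_eigenvalue_def using cu C2 lap bd by blast
qed

end

theory Submission
  imports Defs "HOL-Real_Asymp.Real_Asymp"
begin

text \<open>The discrete eigenfunctions are explicit. With \<open>h = pi / N\<close> let \<open>u\<close> have the value
  \<open>sin (m (i + 1/2) h) * sin (n (j + 1/2) h)\<close> on cell \<open>(i, j)\<close>, and let the first component of \<open>\<sigma>\<close>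
  interpolate a multiple of \<open>cos (m i h)\<close> linearly in \<open>x\<close>, times \<open>sin (n (j + 1/2) h)\<close>, and symmetrically for
  the second. The divergence of \<open>\<sigma>\<close> is then \<open>(\<mu> m + \<mu> n) u\<close> with
  \<open>\<mu> p = 6 (1 - cos (p h)) / (h\<^sup>2 (2 + cos (p h))) = p\<^sup>2 + p\<^sup>4 h\<^sup>2 / 12 + O(h\<^sup>4)\<close>.

  The equation tested with an arbitrary \<open>\<tau>\<close> reduces to a telescoping sum along each row and each column of
  cells, provided that the normal component of \<open>\<tau>\<close> is continuous across edges and that \<open>div \<tau>\<close> is the cellwise
  divergence. Both are extracted from the distributional definition of the divergence by testing
  with products of one-dimensional bumps: bumps tending to the indicator of a cell give the mean of
  the divergence, and bumps shrinking to an edge give the jump of the normal component.\<close>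

section \<open>Smooth bump functions\<close>

text \<open>On rectangles the element is a tensor product: within a cell each component of a field
  depends on its own variable only. The problem therefore splits into one-dimensional mixed problems
  with continuous piecewise linear flux and piecewise constant scalar, and the eigenvalue is a sum
  of two one-dimensional ones. The term p^4 h^2 / 12 is the overestimate familiar from linear
  elements with consistent mass matrix. Two features shape the rest. \<open>divergence\<close> is an
  arbitrary choice among the weak divergences, so nothing pointwise is available for it; but it is
  only ever paired with cellwise constants, so its cell means carry all the information. And fields
  in \<open>Sigma_h\<close> satisfy no boundary condition: the Dirichlet condition on u is natural,
  and it enters only because the sines that multiply the boundary traces of the test field vanish at
  0 and pi.\<close>

lemma Ck_on_SucD:
  assumes "Ck_on (Suc k) UNIV f" shows "Ck_on k UNIV f"
  using assms
proof (induction k arbitrary: f)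
  case 0
  then have "\<And>x. f differentiable at x" by simp
  then show ?case
    by (auto intro!: continuous_at_imp_continuous_on differentiable_imp_continuous_within)
qed auto

lemma has_derivative_frechet:
  "f differentiable at x \<Longrightarrow> (f has_derivative frechet_derivative f (at x)) (at x)"
  by (simp add: frechet_derivative_works)

lemma partial_deriv_eq:
  assumes "(f has_derivative f') (at x)" shows "partial_deriv b f x = f' b"
  using frechet_derivative_at[OF assms] by (simp add: partial_deriv_def)

lemma partial_deriv_add:
  assumes "\<And>x. f differentiable at x" "\<And>x. g differentiable at x"
  shows "partial_deriv b (\<lambda>x. f x + g x) = (\<lambda>x. partial_deriv b f x + partial_deriv b g x)"
  by (rule ext, subst partial_deriv_eq[OF has_derivative_add[OF
        has_derivative_frechet has_derivative_frechet]]) (auto simp: assms partial_deriv_def)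

lemma partial_deriv_mult:
  assumes "\<And>x. f differentiable at x" "\<And>x. g differentiable at x"
  shows "partial_deriv b (\<lambda>x. f x * g x) =
    (\<lambda>x. f x * partial_deriv b g x + partial_deriv b f x * g x)"
  by (rule ext, subst partial_deriv_eq[OF has_derivative_mult[OF
        has_derivative_frechet has_derivative_frechet]]) (auto simp: assms partial_deriv_def)

lemma Ck_on_add:
  "Ck_on k UNIV f \<Longrightarrow> Ck_on k UNIV g \<Longrightarrow> Ck_on k UNIV (\<lambda>x. f x + g x)"
  by (induction k arbitrary: f g) (auto intro: continuous_on_add simp: partial_deriv_add)

text \<open>The product rule brings back the undifferentiated factors, so the induction needs them
  at the lower order as well; \<open>Ck_on_SucD\<close> supplies this, since
  \<open>Ck_on (Suc k)\<close> does not literally contain \<open>Ck_on k\<close>.\<close>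

lemma Ck_on_mult:
  "Ck_on k UNIV f \<Longrightarrow> Ck_on k UNIV g \<Longrightarrow> Ck_on k UNIV (\<lambda>x. f x * g x)"
proof (induction k arbitrary: f g)
  case 0
  then show ?case by (auto intro: continuous_on_mult)
next
  case (Suc k)
  note D = Ck_on_SucD[OF Suc.prems(1)] Ck_on_SucD[OF Suc.prems(2)]
  show ?case using Suc D by (auto simp: partial_deriv_mult intro!: Ck_on_add)
qed

lemma Ck_on_const: "Ck_on k UNIV (\<lambda>x::'a::euclidean_space. c)"
proof (induction k arbitrary: c)
  case (Suc k)
  have "partial_deriv b (\<lambda>x::'a. c) = (\<lambda>x. 0)" for b
    using partial_deriv_eq[OF has_derivative_const] by auto
  then show ?case using Suc by simp
qed simp

text \<open>The exponent \<open>p\<close> makes the span of this family closed under differentiation.\<close>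

definition expinv :: "nat \<Rightarrow> real \<Rightarrow> real" where
  "expinv p x = (if x > 0 then exp (- inverse x) * inverse x ^ p else 0)"

lemma expinv_tendsto_0: "(expinv p \<longlongrightarrow> 0) (at_right 0)"
proof -
  have "((\<lambda>t::real. t ^ p / exp t) \<longlongrightarrow> 0) at_top"
    by (rule tendsto_power_div_exp_0)
  from filterlim_compose[OF this filterlim_inverse_at_top_right]
  have "((\<lambda>x::real. inverse x ^ p / exp (inverse x)) \<longlongrightarrow> 0) (at_right 0)" .
  then show ?thesis
    by (rule Lim_transform_eventually)
      (rule eventually_at_rightI[of 0 1], auto simp: expinv_def exp_minus field_simps)
qed

text \<open>Differentiating the exponential raises the exponent by 2, differentiating the power
  raises it by 1.\<close>

lemma expinv_has_derivative:
  "(expinv p has_real_derivative (expinv (p + 2) x - real p * expinv (p + 1) x)) (at x)"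
proof -
  consider "x > 0" | "x < 0" | "x = 0" by linarith
  then show ?thesis
  proof cases
    case 1
    have "((\<lambda>x. exp (- inverse x) * inverse x ^ p) has_real_derivative
        (expinv (p + 2) x - real p * expinv (p + 1) x)) (at x)"
      using 1
      by (auto intro!: derivative_eq_intros simp: expinv_def algebra_simps power2_eq_square)
         (cases p; simp add: algebra_simps)
    then show ?thesis
      by (rule has_field_derivative_transform_within_open[where S="{0<..}"])
        (use 1 in \<open>auto simp: expinv_def\<close>)
  next
    case 2
    have "((\<lambda>x. 0) has_real_derivative (expinv (p + 2) x - real p * expinv (p + 1) x)) (at x)"
      using 2 by (simp add: expinv_def)
    then show ?thesis
      by (rule has_field_derivative_transform_within_open[where S="{..<0}"])
        (use 2 in \<open>auto simp: expinv_def\<close>)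
  next
    case 3
    \<comment> \<open>Dividing by y raises the exponent by one, so the right difference quotient at
      0 is \<open>expinv (Suc p)\<close>, whose limit is known.\<close>
    have r: "((\<lambda>y. (expinv p y - expinv p 0) / (y - 0)) \<longlongrightarrow> 0) (at_right 0)"
      by (rule Lim_transform_eventually[OF expinv_tendsto_0[of "Suc p"]])
        (rule eventually_at_rightI[of 0 1], auto simp: expinv_def field_simps)
    have l: "((\<lambda>y. (expinv p y - expinv p 0) / (y - 0)) \<longlongrightarrow> 0) (at_left 0)"
      by (rule Lim_transform_eventually[OF tendsto_const])
        (rule eventually_at_leftI[of "-1" 0], auto simp: expinv_def)
    show ?thesis unfolding 3
      using filterlim_split_at[OF l r] by (simp add: has_field_derivative_iff expinv_def)
  qed
qed

lemma continuous_on_expinv: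
  assumes "continuous_on S f" shows "continuous_on S (\<lambda>x. expinv p (f x))"
proof -
  have "isCont (expinv p) x" for x
    using expinv_has_derivative DERIV_isCont by blast
  then have "continuous_on UNIV (expinv p)"
    by (simp add: continuous_on_eq_continuous_at)
  from continuous_on_compose2[OF this assms] show ?thesis by simp
qed

text \<open>Affine arguments let one family serve both coordinates. The induction keeps
  \<open>p\<close> arbitrary because a derivative moves to p + 1 and p + 2.\<close>

lemma Ck_on_expinv: "Ck_on k UNIV (\<lambda>z::'a::euclidean_space. expinv p (c \<bullet> z + \<beta>))"
proof (induction k arbitrary: p)
  case 0
  show ?case
    by (simp add: continuous_on_expinv continuous_on_add continuous_on_inner)
next
  case (Suc k)
  have d: "((\<lambda>z. expinv p (c \<bullet> z + \<beta>)) has_derivative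
      (\<lambda>d. (expinv (p + 2) (c \<bullet> z + \<beta>) - real p * expinv (p + 1) (c \<bullet> z + \<beta>)) * (c \<bullet> d))) (at z)"
    for z
    by (rule has_derivative_compose[of "\<lambda>z. c \<bullet> z + \<beta>" "\<lambda>d. c \<bullet> d" z UNIV "expinv p"])
      (use expinv_has_derivative[of p, unfolded has_field_derivative_def] in
        \<open>auto intro!: derivative_eq_intros\<close>)
  have "partial_deriv b (\<lambda>z. expinv p (c \<bullet> z + \<beta>)) =
      (\<lambda>z. (c \<bullet> b) * expinv (p + 2) (c \<bullet> z + \<beta>)
         + (- real p * (c \<bullet> b)) * expinv (p + 1) (c \<bullet> z + \<beta>))" for b
    by (rule ext, subst partial_deriv_eq[OF d]) (simp add: algebra_simps)
  moreover have "Ck_on k UNIV (\<lambda>z. (c \<bullet> b) * expinv (p + 2) (c \<bullet> z + \<beta>)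
         + (- real p * (c \<bullet> b)) * expinv (p + 1) (c \<bullet> z + \<beta>))" for b
    by (intro Ck_on_add Ck_on_mult Ck_on_const Suc)
  ultimately show ?case
    using d by (auto simp: differentiable_def)
qed

text \<open>The shift by 1 keeps the support \<open>[a + 1/r, b - 1/r]\<close> inside \<open>(a, b)\<close>, so that products of bumps are
  admissible test functions even for cells touching the boundary of the domain.\<close>

definition bump :: "real \<Rightarrow> real \<Rightarrow> real \<Rightarrow> real \<Rightarrow> real" where
  "bump r a b x = expinv 0 (r * (x - a) - 1) * expinv 0 (r * (b - x) - 1)"

lemma expinv0_bounds: "0 \<le> expinv 0 x" "expinv 0 x \<le> 1"
  by (auto simp: expinv_def)

lemma bump_bounds: "0 \<le> bump r a b x" "bump r a b x \<le> 1"
  by (auto simp: bump_def expinv0_bounds mult_le_one)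

lemma bump_pos_iff:
  assumes "r > 0" shows "bump r a b x \<noteq> 0 \<longleftrightarrow> a + 1 / r < x \<and> x < b - 1 / r"
  using assms by (auto simp: bump_def expinv_def field_simps)

lemma continuous_on_bump: "continuous_on S (bump r a b)"
  unfolding bump_def
  by (intro continuous_on_mult continuous_on_expinv continuous_on_diff continuous_on_const
      continuous_on_id)

text \<open>Since exp(-1/t) tends to 1 for large t, steepening the argument alone already gives the
  indicator of the open interval, and all bumps stay below 1, as dominated convergence will
  require.\<close>

lemma bump_tendsto: "(\<lambda>k. bump (real k) a b x) \<longlonglongrightarrow> indicator {a<..<b} x"
proof -
  have *: "(\<lambda>k. expinv 0 (real k * d - 1)) \<longlonglongrightarrow> (if d > 0 then 1 else 0)" for d
  proof (cases "d > 0")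
    case True
    have "filterlim (\<lambda>k. - 1 + d * real k) at_top sequentially"
      by (rule filterlim_tendsto_add_at_top[OF tendsto_const
          filterlim_tendsto_pos_mult_at_top[OF tendsto_const True filterlim_real_sequentially]])
    then have l: "filterlim (\<lambda>k. real k * d - 1) at_top sequentially"
      by (simp add: algebra_simps)
    have lim: "(\<lambda>k. exp (- inverse (real k * d - 1))) \<longlonglongrightarrow> exp (- 0)"
      by (intro tendsto_exp tendsto_minus tendsto_inverse_0_at_top l)
    have "\<forall>\<^sub>F k in sequentially. exp (- inverse (real k * d - 1)) = expinv 0 (real k * d - 1)"
      using filterlim_at_top_dense[THEN iffD1, rule_format, OF l, of 0]
      by (rule eventually_mono) (simp add: expinv_def)
    from Lim_transform_eventually[OF lim this] True show ?thesis by simp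
  next
    case False
    then have "real k * d \<le> 0" for k by (simp add: mult_nonneg_nonpos)
    then have "real k * d - 1 \<le> 0" for k by (meson diff_le_0_iff_le dual_order.trans zero_le_one)
    then have "expinv 0 (real k * d - 1) = 0" for k by (simp add: expinv_def not_less)
    with False show ?thesis by simp
  qed
  have "(\<lambda>k. bump (real k) a b x) \<longlonglongrightarrow>
      (if x - a > 0 then 1 else 0) * (if b - x > 0 then 1 else 0)"
    unfolding bump_def by (intro tendsto_mult *)
  moreover have "(if x - a > 0 then 1 else 0) * (if b - x > 0 then 1 else 0) =
      (indicator {a<..<b} x :: real)"
    by (simp add: indicator_def)
  ultimately show ?thesis by simp
qed

lemma interior_Omega: "interior Omega = {0<..<pi} \<times> {0<..<pi}"
  by (simp add: Omega_def interior_Times)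

text \<open>The hypotheses constrain the shrunken supports only, so the rectangle with corners (a,
  c) and (b, d) may touch or overhang the boundary of the domain.\<close>

lemma bump_product_test_function:
  assumes "r > 0" "s > 0" "0 < a + 1 / r" "b - 1 / r < pi" "0 < c + 1 / s" "d - 1 / s < pi"
  shows "(\<lambda>z. bump r a b (fst z) * bump s c d (snd z)) \<in> test_functions (interior Omega)"
    (is "?\<phi> \<in> _")
proof -
  let ?K = "{a + 1 / r .. b - 1 / r} \<times> {c + 1 / s .. d - 1 / s}"
  have "{x. ?\<phi> x \<noteq> 0} \<subseteq> ?K"
  proof
    fix z assume "z \<in> {x. ?\<phi> x \<noteq> 0}"
    then have "bump r a b (fst z) \<noteq> 0" "bump s c d (snd z) \<noteq> 0" by auto
    then show "z \<in> ?K"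
      unfolding bump_pos_iff[OF assms(1)] bump_pos_iff[OF assms(2)] by (simp add: mem_Times_iff)
  qed
  then have cl: "closure {x. ?\<phi> x \<noteq> 0} \<subseteq> ?K"
    by (rule closure_minimal) (auto intro!: closed_Times)
  have "compact ?K" by (intro compact_Times) auto
  then have "compact (?K \<inter> closure {x. ?\<phi> x \<noteq> 0})"
    by (rule compact_Int_closed) (rule closed_closure)
  then have "compact (closure {x. ?\<phi> x \<noteq> 0})"
    unfolding inf.absorb2[OF cl] .
  moreover have "?K \<subseteq> interior Omega" using assms by (auto simp: interior_Omega)
  moreover have "Ck_on k UNIV ?\<phi>" for k
  proof -
    \<comment> \<open>All four factors become \<open>expinv\<close> of an affine form on the plane,
      the shape that \<open>Ck_on_expinv\<close> handles.\<close>
    have e: "?\<phi> = (\<lambda>z. (expinv 0 ((r, 0) \<bullet> z + (- r * a - 1)) * expinv 0 ((- r, 0) \<bullet> z + (r * b - 1))) *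
       (expinv 0 ((0, s) \<bullet> z + (- s * c - 1)) * expinv 0 ((0, - s) \<bullet> z + (s * d - 1))))"
      by (auto simp: bump_def fun_eq_iff inner_prod_def algebra_simps)
    show ?thesis unfolding e by (intro Ck_on_mult Ck_on_expinv)
  qed
  ultimately show ?thesis
    unfolding test_functions_def mem_Collect_eq using cl by blast
qed

section \<open>Integration over the mesh\<close>

lemma L2_space_integrable:
  fixes g :: "'a::euclidean_space \<Rightarrow> real"
  assumes "g \<in> L2_space S" "S \<in> lmeasurable"
  shows "integrable (lebesgue_on S) g"
proof -
  have "finite_measure (lebesgue_on S)"
    using assms(2) by (rule finite_measure_lebesgue_on)
  moreover have "g \<in> borel_measurable (lebesgue_on S)"
    using assms(1) unfolding L2_space_def mem_Collect_eq by (rule conjunct1)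
  moreover have "integrable (lebesgue_on S) (\<lambda>x. g x ^ 2)"
    using assms(1) unfolding L2_space_def mem_Collect_eq by simp
  ultimately show ?thesis
    by (rule finite_measure.square_integrable_imp_integrable)
qed

lemma Omega_lmeasurable: "Omega \<in> lmeasurable"
proof -
  have "Omega = cbox (0, 0) (pi, pi)" by (auto simp: Omega_def cbox_Pair_eq)
  then show ?thesis by (metis lmeasurable_cbox)
qed

lemma Omega_sets: "Omega \<in> sets lebesgue"
  using Omega_lmeasurable by (rule fmeasurableD)

lemma integrable_lebesgue_on_iff:
  fixes f :: "'a::euclidean_space \<Rightarrow> real"
  assumes "S \<in> sets lebesgue"
  shows "integrable (lebesgue_on S) f \<longleftrightarrow> set_integrable lebesgue S f"
    and "integral\<^sup>L (lebesgue_on S) f = set_lebesgue_integral lebesgue S f"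
  using assms
  by (auto simp: integrable_restrict_space integral_restrict_space set_integrable_def
      set_lebesgue_integral_def)

lemma integrable_lebesgue_on_mult_bounded:
  fixes f \<phi> :: "'a::euclidean_space \<Rightarrow> real"
  assumes S: "S \<in> sets lebesgue" and f: "integrable (lebesgue_on S) f" and c: "continuous_on UNIV \<phi>"
    and B: "\<And>x. \<bar>\<phi> x\<bar> \<le> B"
  shows "integrable (lebesgue_on S) (\<lambda>x. f x * \<phi> x)"
proof (rule Bochner_Integration.integrable_bound)
  show "integrable (lebesgue_on S) (\<lambda>x. B * \<bar>f x\<bar>)" using f by auto
  have "\<phi> \<in> borel_measurable (lebesgue_on S)"
    using c S by (meson continuous_imp_measurable_on_sets_lebesgue continuous_on_subset subset_UNIV)
  then show "(\<lambda>x. f x * \<phi> x) \<in> borel_measurable (lebesgue_on S)" using f by auto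
  have "\<bar>f x\<bar> * \<bar>\<phi> x\<bar> \<le> \<bar>B\<bar> * \<bar>f x\<bar>" for x
    using mult_left_mono[of "\<bar>\<phi> x\<bar>" "\<bar>B\<bar>" "\<bar>f x\<bar>"] B[of x] by (simp add: mult.commute)
  then show "AE x in lebesgue_on S. norm (f x * \<phi> x) \<le> norm (B * \<bar>f x\<bar>)"
    by (simp add: abs_mult)
qed

text \<open>Integration by parts on each horizontal line: the affine weight has constant derivative
  \<open>\<beta>\<close>, and the end terms integrate to the two vertical edges. This is one half of
  Green's formula for a Raviart-Thomas field on a cell.\<close>

lemma integral_horizontal_parts:
  fixes \<phi> \<phi>' :: "real \<times> real \<Rightarrow> real"
  assumes "a \<le> b"
    and d: "\<And>x y. ((\<lambda>x. \<phi> (x, y)) has_real_derivative \<phi>' (x, y)) (at x)"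
    and c: "continuous_on UNIV \<phi>" "continuous_on UNIV \<phi>'"
  shows "integral (cbox (a, c) (b, d)) (\<lambda>z. (\<alpha> + \<beta> * fst z) * \<phi>' z) =
    (\<alpha> + \<beta> * b) * integral {c..d} (\<lambda>y. \<phi> (b, y))
    - (\<alpha> + \<beta> * a) * integral {c..d} (\<lambda>y. \<phi> (a, y))
    - \<beta> * integral (cbox (a, c) (b, d)) \<phi>"
proof -
  let ?C = "cbox (a, c) (b, d)"
  let ?F = "\<lambda>z. (\<alpha> + \<beta> * fst z) * \<phi>' z + \<beta> * \<phi> z"
  have cS: "continuous_on S \<phi>" "continuous_on S \<phi>'" for S
    using c by (auto intro: continuous_on_subset)
  have cF: "continuous_on S ?F" for S by (intro continuous_intros cS)
  have cy: "continuous_on S (\<lambda>y. \<phi> (x, y))" for x S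
    by (intro continuous_on_compose2[OF c(1)] continuous_intros) auto
  have inner: "integral {a..b} (\<lambda>x. ?F (x, y)) =
      (\<alpha> + \<beta> * b) * \<phi> (b, y) - (\<alpha> + \<beta> * a) * \<phi> (a, y)" for y
  proof -
    have "((\<lambda>x. ?F (x, y)) has_integral
        ((\<alpha> + \<beta> * b) * \<phi> (b, y) - (\<alpha> + \<beta> * a) * \<phi> (a, y))) {a..b}"
    proof (rule fundamental_theorem_of_calculus[OF assms(1)])
      fix x
      have "((\<lambda>x. (\<alpha> + \<beta> * x) * \<phi> (x, y)) has_real_derivative ?F (x, y)) (at x)"
        by (auto intro!: derivative_eq_intros d)
      then show "((\<lambda>x. (\<alpha> + \<beta> * x) * \<phi> (x, y)) has_vector_derivative ?F (x, y))
          (at x within {a..b})"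
        using has_real_derivative_iff_has_vector_derivative has_vector_derivative_at_within by blast
    qed
    then show ?thesis by (simp add: integral_unique)
  qed
  have "integral ?C ?F = integral (cbox a b) (\<lambda>x. integral (cbox c d) (\<lambda>y. ?F (x, y)))"
    by (rule integral_prod_continuous[OF cF])
  \<comment> \<open>The order is exchanged to make x the inner variable, where \<open>inner\<close>
    applies. In the vertical version y is the inner variable from the start.\<close>
  also have "\<dots> = integral (cbox c d) (\<lambda>y. integral (cbox a b) (\<lambda>x. ?F (x, y)))"
    by (rule integral_swap_continuous) (simp add: split_def cF[simplified])
  also have "\<dots> = integral {c..d} (\<lambda>y. (\<alpha> + \<beta> * b) * \<phi> (b, y) - (\<alpha> + \<beta> * a) * \<phi> (a, y))"
    by (simp only: box_real inner)
  also have "\<dots> = (\<alpha> + \<beta> * b) * integral {c..d} (\<lambda>y. \<phi> (b, y))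
    - (\<alpha> + \<beta> * a) * integral {c..d} (\<lambda>y. \<phi> (a, y))"
    by (subst integral_diff) (auto intro!: integrable_continuous_real continuous_intros cy)
  finally have "integral ?C ?F = \<dots>" .
  moreover have "integral ?C ?F = integral ?C (\<lambda>z. (\<alpha> + \<beta> * fst z) * \<phi>' z) + \<beta> * integral ?C \<phi>"
    by (subst integral_add) (auto intro!: integrable_continuous continuous_intros cS)
  ultimately show ?thesis by simp
qed

lemma integral_vertical_parts:
  fixes \<phi> \<phi>' :: "real \<times> real \<Rightarrow> real"
  assumes "c \<le> d"
    and d: "\<And>x y. ((\<lambda>y. \<phi> (x, y)) has_real_derivative \<phi>' (x, y)) (at y)"
    and c: "continuous_on UNIV \<phi>" "continuous_on UNIV \<phi>'"
  shows "integral (cbox (a, c) (b, d)) (\<lambda>z. (\<alpha> + \<beta> * snd z) * \<phi>' z) =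
    (\<alpha> + \<beta> * d) * integral {a..b} (\<lambda>x. \<phi> (x, d))
    - (\<alpha> + \<beta> * c) * integral {a..b} (\<lambda>x. \<phi> (x, c))
    - \<beta> * integral (cbox (a, c) (b, d)) \<phi>"
proof -
  let ?C = "cbox (a, c) (b, d)"
  let ?F = "\<lambda>z. (\<alpha> + \<beta> * snd z) * \<phi>' z + \<beta> * \<phi> z"
  have cS: "continuous_on S \<phi>" "continuous_on S \<phi>'" for S
    using c by (auto intro: continuous_on_subset)
  have cF: "continuous_on S ?F" for S by (intro continuous_intros cS)
  have cx: "continuous_on S (\<lambda>x. \<phi> (x, y))" for y S
    by (intro continuous_on_compose2[OF c(1)] continuous_intros) auto
  have inner: "integral {c..d} (\<lambda>y. ?F (x, y)) =
      (\<alpha> + \<beta> * d) * \<phi> (x, d) - (\<alpha> + \<beta> * c) * \<phi> (x, c)" for x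
  proof -
    have "((\<lambda>y. ?F (x, y)) has_integral
        ((\<alpha> + \<beta> * d) * \<phi> (x, d) - (\<alpha> + \<beta> * c) * \<phi> (x, c))) {c..d}"
    proof (rule fundamental_theorem_of_calculus[OF assms(1)])
      fix y
      have "((\<lambda>y. (\<alpha> + \<beta> * y) * \<phi> (x, y)) has_real_derivative ?F (x, y)) (at y)"
        by (auto intro!: derivative_eq_intros d)
      then show "((\<lambda>y. (\<alpha> + \<beta> * y) * \<phi> (x, y)) has_vector_derivative ?F (x, y))
          (at y within {c..d})"
        using has_real_derivative_iff_has_vector_derivative has_vector_derivative_at_within by blast
    qed
    then show ?thesis by (simp add: integral_unique)
  qed
  have "integral ?C ?F = integral (cbox a b) (\<lambda>x. integral (cbox c d) (\<lambda>y. ?F (x, y)))"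
    by (rule integral_prod_continuous[OF cF])
  also have "\<dots> = integral {a..b} (\<lambda>x. (\<alpha> + \<beta> * d) * \<phi> (x, d) - (\<alpha> + \<beta> * c) * \<phi> (x, c))"
    by (simp only: box_real inner)
  also have "\<dots> = (\<alpha> + \<beta> * d) * integral {a..b} (\<lambda>x. \<phi> (x, d))
    - (\<alpha> + \<beta> * c) * integral {a..b} (\<lambda>x. \<phi> (x, c))"
    by (subst integral_diff) (auto intro!: integrable_continuous_real continuous_intros cx)
  finally have "integral ?C ?F = \<dots>" .
  moreover have "integral ?C ?F = integral ?C (\<lambda>z. (\<alpha> + \<beta> * snd z) * \<phi>' z) + \<beta> * integral ?C \<phi>"
    by (subst integral_add) (auto intro!: integrable_continuous continuous_intros cS)
  ultimately show ?thesis by simp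
qed

lemma integral_tensor:
  fixes f g :: "real \<Rightarrow> real"
  assumes "continuous_on UNIV f" "continuous_on UNIV g"
  shows "integral (cbox (a, c) (b, d)) (\<lambda>z. f (fst z) * g (snd z)) =
    integral {a..b} f * integral {c..d} g"
proof -
  have "continuous_on S (\<lambda>z. f (fst z) * g (snd z))" for S
    by (intro continuous_intros continuous_on_compose2[OF assms(1)]
        continuous_on_compose2[OF assms(2)]) auto
  then show ?thesis
    by (subst integral_prod_continuous) auto
qed

section \<open>Mesh cells and cellwise integration\<close>

definition cell :: "real \<Rightarrow> nat \<Rightarrow> nat \<Rightarrow> (real \<times> real) set" where
  "cell h i j = cbox (real i * h, real j * h) (real (Suc i) * h, real (Suc j) * h)"

lemma cell_sets: "cell h i j \<in> sets lebesgue"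
  by (auto simp: cell_def)

text \<open>The closed cells share their edges, so a point determines its cell only off the
  frontiers, which are null.\<close>

lemma AE_interior_cell:
  "AE x in lebesgue. x \<in> cell h i j \<longrightarrow>
    x \<in> box (real i * h, real j * h) (real (Suc i) * h, real (Suc j) * h)"
proof -
  have "cell h i j - box (real i * h, real j * h) (real (Suc i) * h, real (Suc j) * h)
      \<in> null_sets lebesgue"
    using negligible_frontier_interval unfolding cell_def negligible_iff_null_sets by blast
  from AE_not_in[OF this] show ?thesis by (rule AE_mp) auto
qed

lemma box_Pair: "(x, y) \<in> box (a, b) (c, d) \<longleftrightarrow> a < x \<and> x < c \<and> b < y \<and> y < (d::real)" for a :: real
  by (auto simp: box_def Basis_prod_def)

lemma cell_Pair: "(x, y) \<in> cell h i j \<longleftrightarrow>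
    real i * h \<le> x \<and> x \<le> real (Suc i) * h \<and> real j * h \<le> y \<and> y \<le> real (Suc j) * h"
  by (auto simp: cell_def cbox_Pair_eq)

locale mesh =
  fixes N :: nat and h :: real
  assumes h_pos: "h > 0" and N_h: "real N * h = pi"
begin

lemma N_pos: "N > 0"
  using N_h by (cases N) auto

lemma node_less_iff: "real i * h < real j * h \<longleftrightarrow> i < j"
  using h_pos by simp

lemma node_le_pi_iff: "real i * h \<le> pi \<longleftrightarrow> i \<le> N"
  using h_pos by (simp flip: N_h)

lemma uniform_mesh_eq: "uniform_mesh h = {cell h i j | i j. i < N \<and> j < N}"
proof -
  have "real (i + 1) * h \<le> pi \<longleftrightarrow> i < N" for i
    using node_le_pi_iff[of "i + 1"] by linarith
  then show ?thesis
    unfolding uniform_mesh_def cell_def cbox_Pair_eq box_real Suc_eq_plus1 by presburger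
qed

lemma exists_cell_index:
  assumes "0 \<le> x" "x \<le> pi"
  shows "\<exists>i<N. real i * h \<le> x \<and> x \<le> real (Suc i) * h"
proof (cases "x = pi")
  \<comment> \<open>At the right end the floor would give \<open>N\<close>, one past the last
    interval, so the index is N - 1.\<close>
  case True
  then show ?thesis using N_pos N_h h_pos
    by (intro exI[of _ "N - 1"]) (auto simp: of_nat_diff algebra_simps)
next
  case False
  define i where "i = nat \<lfloor>x / h\<rfloor>"
  have i: "real i \<le> x / h" "x / h < real i + 1"
    using assms h_pos by (auto simp: i_def)
  then have "real i * h \<le> x" "x \<le> real (Suc i) * h"
    using h_pos by (auto simp: field_simps)
  moreover have "i < N"
    using calculation(1) False assms(2) node_less_iff[of i N] N_h by linarith
  ultimately show ?thesis by blast
qed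

lemma Omega_eq_cells: "Omega = (\<Union>(i, j)\<in>{..<N} \<times> {..<N}. cell h i j)"
proof (intro set_eqI iffI)
  fix z assume "z \<in> Omega"
  then obtain x y where z: "z = (x, y)" "0 \<le> x" "x \<le> pi" "0 \<le> y" "y \<le> pi"
    by (auto simp: Omega_def)
  show "z \<in> (\<Union>(i, j)\<in>{..<N} \<times> {..<N}. cell h i j)"
    using exists_cell_index[OF z(2,3)] exists_cell_index[OF z(4,5)]
    by (force simp: z cell_Pair)
next
  fix z assume "z \<in> (\<Union>(i, j)\<in>{..<N} \<times> {..<N}. cell h i j)"
  then obtain i j where ij: "i < N" "j < N" "z \<in> cell h i j" by auto
  have "0 \<le> real i * h" "0 \<le> real j * h" using h_pos by auto
  moreover have "real (Suc i) * h \<le> pi" "real (Suc j) * h \<le> pi"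
    using ij node_le_pi_iff by (auto simp: Suc_le_eq simp del: of_nat_Suc)
  ultimately show "z \<in> Omega"
    using ij(3) by (cases z) (auto simp: Omega_def cell_Pair simp del: of_nat_Suc)
qed

lemma cell_index_unique:
  assumes "real i * h < x" "x < real (Suc i) * h" "real i' * h \<le> x" "x \<le> real (Suc i') * h"
  shows "i = i'"
proof -
  have "real i * h < real (Suc i') * h" "real i' * h < real (Suc i) * h"
    using assms by linarith+
  then show ?thesis by (simp only: node_less_iff)
qed

lemma cell_subset_Omega: "i < N \<Longrightarrow> j < N \<Longrightarrow> cell h i j \<subseteq> Omega"
  unfolding Omega_eq_cells by blast

text \<open>A point interior to one cell lies in no other cell, so the cells are disjoint almost
  everywhere; this is enough for additivity of the integral.\<close>

lemma cells_integral:
  fixes f :: "real \<times> real \<Rightarrow> real"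
  assumes "\<And>i j. i < N \<Longrightarrow> j < N \<Longrightarrow> integrable (lebesgue_on (cell h i j)) f"
  shows "integrable (lebesgue_on Omega) f"
    and "integral\<^sup>L (lebesgue_on Omega) f =
      (\<Sum>i<N. \<Sum>j<N. integral\<^sup>L (lebesgue_on (cell h i j)) f)"
proof -
  let ?I = "{..<N} \<times> {..<N}" and ?A = "\<lambda>p. cell h (fst p) (snd p)"
  have O: "Omega = (\<Union>p\<in>?I. ?A p)" by (simp add: Omega_eq_cells split_def)
  have si: "set_integrable lebesgue (?A p) f" if "p \<in> ?I" for p
    using assms[of "fst p" "snd p"] that by (auto simp: integrable_lebesgue_on_iff cell_sets)
  show "integrable (lebesgue_on Omega) f"
    unfolding integrable_lebesgue_on_iff[OF Omega_sets] unfolding O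
    by (intro set_integrable_UN si cell_sets) auto
  have ae: "AE x in lebesgue. (x \<in> ?A p \<and> x \<in> ?A q) \<longrightarrow> p = q" for p q
    using AE_interior_cell[of h "fst p" "snd p"]
  proof (rule AE_mp, intro AE_I2 impI)
    fix z assume *: "z \<in> ?A p \<longrightarrow>
      z \<in> box (real (fst p) * h, real (snd p) * h) (real (Suc (fst p)) * h, real (Suc (snd p)) * h)"
      "z \<in> ?A p \<and> z \<in> ?A q"
    show "p = q"
      using * cell_index_unique[of "fst p" "fst z" "fst q"] cell_index_unique[of "snd p" "snd z" "snd q"]
      by (cases z, cases p, cases q) (auto simp: box_Pair cell_Pair simp del: of_nat_Suc)
  qed
  have "integral\<^sup>L (lebesgue_on Omega) f = (\<Sum>p\<in>?I. set_lebesgue_integral lebesgue (?A p) f)"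
    unfolding integrable_lebesgue_on_iff[OF Omega_sets] unfolding O
    by (intro set_integral_finite_UN_AE ae si cell_sets) auto
  then show "integral\<^sup>L (lebesgue_on Omega) f =
      (\<Sum>i<N. \<Sum>j<N. integral\<^sup>L (lebesgue_on (cell h i j)) f)"
    by (simp add: integrable_lebesgue_on_iff cell_sets sum.cartesian_product split_def)
qed

lemma integrable_on_cell:
  fixes f :: "real \<times> real \<Rightarrow> real"
  assumes "integrable (lebesgue_on Omega) f" "i < N" "j < N"
  shows "integrable (lebesgue_on (cell h i j)) f"
  using assms set_integrable_subset[of lebesgue Omega f "cell h i j"] cell_subset_Omega[of i j]
  by (auto simp: integrable_lebesgue_on_iff cell_sets Omega_sets)

lemma measurable_on_cell:
  assumes "f \<in> borel_measurable (lebesgue_on Omega)" "i < N" "j < N"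
  shows "f \<in> borel_measurable (lebesgue_on (cell h i j))"
  using measurable_restrict_mono[OF assms(1) cell_subset_Omega[OF assms(2,3)]] .

text \<open>Bridge from the Bochner integral of a function known only up to null sets to the gauge
  integral of its continuous representative, for which Fubini and the fundamental theorem of
  calculus are used.\<close>

lemma cell_integral_AE:
  fixes f F :: "real \<times> real \<Rightarrow> real"
  assumes "f \<in> borel_measurable (lebesgue_on Omega)" "i < N" "j < N"
    and "AE x in lebesgue_on (cell h i j). f x = F x" "continuous_on (cell h i j) F"
  shows "integrable (lebesgue_on (cell h i j)) f"
    and "integral\<^sup>L (lebesgue_on (cell h i j)) f = integral (cell h i j) F"
proof -
  note mf = measurable_on_cell[OF assms(1-3)]
  have iF: "integrable (lebesgue_on (cell h i j)) F"
    using assms(5) continuous_imp_integrable unfolding cell_def by blast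
  note mF = borel_measurable_integrable[OF iF]
  show "integrable (lebesgue_on (cell h i j)) f"
    using integrable_cong_AE[OF mf mF assms(4)] iF by blast
  show "integral\<^sup>L (lebesgue_on (cell h i j)) f = integral (cell h i j) F"
    using integral_cong_AE[OF mf mF assms(4)] lebesgue_integral_eq_integral[OF iF cell_sets] by simp
qed

lemma Omega_integral_piecewise:
  fixes f :: "real \<times> real \<Rightarrow> real"
  assumes "f \<in> borel_measurable (lebesgue_on Omega)"
    and "\<And>i j. i < N \<Longrightarrow> j < N \<Longrightarrow> AE x in lebesgue_on (cell h i j). f x = F i j x"
    and "\<And>i j. i < N \<Longrightarrow> j < N \<Longrightarrow> continuous_on (cell h i j) (F i j)"
  shows "integrable (lebesgue_on Omega) f"
    and "integral\<^sup>L (lebesgue_on Omega) f = (\<Sum>i<N. \<Sum>j<N. integral (cell h i j) (F i j))"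
proof -
  note c = cell_integral_AE[OF assms(1) _ _ assms(2) assms(3)]
  show "integrable (lebesgue_on Omega) f" using c(1) by (intro cells_integral(1)) auto
  show "integral\<^sup>L (lebesgue_on Omega) f = (\<Sum>i<N. \<Sum>j<N. integral (cell h i j) (F i j))"
    using c by (subst cells_integral(2)) auto
qed

end

section \<open>Weak divergence of piecewise Raviart-Thomas fields\<close>

lemma borel_measurable_lebesgue_on:
  "f \<in> borel_measurable borel \<Longrightarrow> f \<in> borel_measurable (lebesgue_on S)"
  by (intro measurable_restrict_space1 measurable_completion) simp

lemma Basis_real_prod: "(Basis :: (real \<times> real) set) = {(1, 0), (0, 1)}"
  by (auto simp: Basis_prod_def)

text \<open>The partial derivatives come from the Frechet derivative; composing with the embeddings
  of horizontal and vertical lines turns them into the one-variable derivatives that integration by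
  parts needs.\<close>

lemma test_function_derivs:
  fixes \<phi> :: "real \<times> real \<Rightarrow> real"
  assumes "\<phi> \<in> test_functions S"
  shows "continuous_on T \<phi>"
    and "continuous_on T (partial_deriv (1, 0) \<phi>)"
    and "continuous_on T (partial_deriv (0, 1) \<phi>)"
    and "((\<lambda>x. \<phi> (x, y)) has_real_derivative partial_deriv (1, 0) \<phi> (x, y)) (at x)"
    and "((\<lambda>y. \<phi> (x, y)) has_real_derivative partial_deriv (0, 1) \<phi> (x, y)) (at y)"
    and "grad \<phi> z = (partial_deriv (1, 0) \<phi> z, partial_deriv (0, 1) \<phi> z)"
    and "z \<notin> S \<Longrightarrow> \<phi> z = 0"
proof -
  have C: "Ck_on k UNIV \<phi>" for k using assms by (simp add: test_functions_def)
  have "continuous_on UNIV \<phi>" using C[of 0] by simp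
  then show "continuous_on T \<phi>" by (rule continuous_on_subset) simp
  have "continuous_on UNIV (partial_deriv b \<phi>)" if "b \<in> Basis" for b
    using C[of 1] that by simp
  then show "continuous_on T (partial_deriv (1, 0) \<phi>)" "continuous_on T (partial_deriv (0, 1) \<phi>)"
    by (auto simp: Basis_real_prod intro: continuous_on_subset[of UNIV])
  have D: "(\<phi> has_derivative frechet_derivative \<phi> (at z)) (at z)" for z
    using C[of "Suc 0"] by (simp only: Ck_on.simps ball_UNIV has_derivative_frechet)
  have lin: "frechet_derivative \<phi> (at z) (t *\<^sub>R b) = t * partial_deriv b \<phi> z" for z t b
    using linear_scale[OF has_derivative_linear[OF D]] by (simp add: partial_deriv_def)
  show "((\<lambda>x. \<phi> (x, y)) has_real_derivative partial_deriv (1, 0) \<phi> (x, y)) (at x)"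
  proof -
    have "((\<lambda>x. \<phi> (x, y)) has_derivative (\<lambda>t. frechet_derivative \<phi> (at (x, y)) (t, 0))) (at x)"
      by (rule has_derivative_compose[OF _ D]) (auto intro!: derivative_eq_intros)
    moreover have "frechet_derivative \<phi> (at (x, y)) (t, 0) = partial_deriv (1, 0) \<phi> (x, y) * t" for t
      using lin[of "(x, y)" t "(1, 0)"] by (simp add: mult.commute)
    ultimately show ?thesis by (simp add: has_field_derivative_def)
  qed
  show "((\<lambda>y. \<phi> (x, y)) has_real_derivative partial_deriv (0, 1) \<phi> (x, y)) (at y)"
  proof -
    have "((\<lambda>y. \<phi> (x, y)) has_derivative (\<lambda>t. frechet_derivative \<phi> (at (x, y)) (0, t))) (at y)"
      by (rule has_derivative_compose[OF _ D]) (auto intro!: derivative_eq_intros)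
    moreover have "frechet_derivative \<phi> (at (x, y)) (0, t) = partial_deriv (0, 1) \<phi> (x, y) * t" for t
      using lin[of "(x, y)" t "(0, 1)"] by (simp add: mult.commute)
    ultimately show ?thesis by (simp add: has_field_derivative_def)
  qed
  show "grad \<phi> z = (partial_deriv (1, 0) \<phi> z, partial_deriv (0, 1) \<phi> z)"
    by (simp add: grad_def Basis_real_prod)
  have "closure {x. \<phi> x \<noteq> 0} \<subseteq> S" using assms by (simp add: test_functions_def)
  then show "z \<notin> S \<Longrightarrow> \<phi> z = 0"
    using closure_subset[of "{x. \<phi> x \<noteq> 0}"] by blast
qed

text \<open>Dominated convergence with majorant |f|. The limit is required almost everywhere only,
  because bumps that shrink to an edge do not tend to 0 on the edge itself.\<close>

lemma tendsto_integral_bounded_mult: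
  fixes f :: "'a::euclidean_space \<Rightarrow> real"
  assumes S: "S \<in> sets lebesgue" and f: "integrable (lebesgue_on S) f"
    and c: "\<And>k. continuous_on UNIV (\<phi> k)" and B: "\<And>k z. \<bar>\<phi> k z\<bar> \<le> (1::real)"
    and \<psi>: "\<psi> \<in> borel_measurable borel"
    and lim: "AE z in lebesgue. (\<lambda>k::nat. \<phi> k z) \<longlonglongrightarrow> \<psi> z"
  shows "(\<lambda>k. \<integral>z. f z * \<phi> k z \<partial>lebesgue_on S) \<longlonglongrightarrow> (\<integral>z. f z * \<psi> z \<partial>lebesgue_on S)"
proof (rule integral_dominated_convergence[where w = "\<lambda>z. \<bar>f z\<bar>"])
  note mf = borel_measurable_integrable[OF f]
  show "(\<lambda>z. f z * \<psi> z) \<in> borel_measurable (lebesgue_on S)"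
    by (rule borel_measurable_times[OF mf borel_measurable_lebesgue_on[OF \<psi>]])
  show "(\<lambda>z. f z * \<phi> k z) \<in> borel_measurable (lebesgue_on S)" for k
    by (rule borel_measurable_times[OF mf
        borel_measurable_lebesgue_on[OF borel_measurable_continuous_onI[OF c]]])
  show "integrable (lebesgue_on S) (\<lambda>z. \<bar>f z\<bar>)" using f by (rule integrable_abs)
  have "AE z in lebesgue_on S. (\<lambda>k. \<phi> k z) \<longlonglongrightarrow> \<psi> z"
    using lim by (simp add: AE_restrict_space_iff S) (erule eventually_mono, simp)
  then show "AE z in lebesgue_on S. (\<lambda>k. f z * \<phi> k z) \<longlonglongrightarrow> f z * \<psi> z"
    by (rule AE_mp) (auto intro!: AE_I2 tendsto_mult_left)
  have "\<bar>f z\<bar> * \<bar>\<phi> k z\<bar> \<le> \<bar>f z\<bar>" for k z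
    using mult_left_mono[OF B[of k z], of "\<bar>f z\<bar>"] by simp
  then show "AE z in lebesgue_on S. norm (f z * \<phi> k z) \<le> \<bar>f z\<bar>" for k
    by (simp add: abs_mult)
qed

lemma bump_eq_0:
  assumes "r > 0" "x \<le> a \<or> b \<le> x" shows "bump r a b x = 0"
proof -
  have "1 / r > 0" using assms(1) by simp
  then have "\<not> (a + 1 / r < x \<and> x < b - 1 / r)" using assms(2) by linarith
  then show ?thesis using bump_pos_iff[OF assms(1)] by blast
qed

lemma bump_product_le_1: "\<bar>bump r a b x * bump s c d y\<bar> \<le> 1"
  using bump_bounds[of r a b x] bump_bounds[of s c d y]
  by (simp add: abs_mult mult_le_one)

lemma continuous_on_bump_product:
  "continuous_on S (\<lambda>z::real\<times>real. bump r a b (fst z) * bump s c d (snd z))"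
  by (intro continuous_on_mult continuous_on_compose2[OF continuous_on_bump[of UNIV]]
      continuous_on_fst continuous_on_snd continuous_on_id) auto

text \<open>With sharpness 4 / (b - a) the support is the middle half of the interval and contains
  the midpoint.\<close>

lemma integral_bump_pos:
  assumes "a < b" shows "integral {a..b} (bump (4 / (b - a)) a b) > 0"
proof -
  let ?f = "bump (4 / (b - a)) a b" and ?m = "(a + b) / 2"
  have c: "continuous_on {a..b} ?f" by (rule continuous_on_bump)
  have m: "?m \<in> {a..b}" using assms by auto
  have "?f ?m \<noteq> 0"
    using assms by (subst bump_pos_iff) (auto simp: field_simps)
  then have "integral {a..b} ?f \<noteq> 0"
    using integral_eq_0_iff[OF c assms] bump_bounds(1) m by blast
  moreover have "integral {a..b} ?f \<ge> 0"
    by (rule integral_nonneg) (auto intro: integrable_continuous_real c bump_bounds)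
  ultimately show ?thesis by linarith
qed

context mesh begin

text \<open>Edges carry the index of the cell to their right (here) or above them
  (\<open>H_edge\<close>); the opposite edge of cell (i, j) has the index \<open>Suc i\<close> or
  \<open>Suc j\<close>.\<close>

definition V_edge :: "(real \<times> real \<Rightarrow> real) \<Rightarrow> nat \<Rightarrow> nat \<Rightarrow> real" where
  "V_edge \<phi> i j = integral {real j * h .. real (Suc j) * h} (\<lambda>y. \<phi> (real i * h, y))"

definition H_edge :: "(real \<times> real \<Rightarrow> real) \<Rightarrow> nat \<Rightarrow> nat \<Rightarrow> real" where
  "H_edge \<phi> i j = integral {real i * h .. real (Suc i) * h} (\<lambda>x. \<phi> (x, real j * h))"

text \<open>No continuity across edges is built into this predicate: the coefficients of neighbouring cells
  are unrelated.\<close>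

definition RT_coeffs ::
    "(real \<times> real \<Rightarrow> real \<times> real) \<Rightarrow> (nat \<Rightarrow> nat \<Rightarrow> real) \<Rightarrow> (nat \<Rightarrow> nat \<Rightarrow> real) \<Rightarrow>
     (nat \<Rightarrow> nat \<Rightarrow> real) \<Rightarrow> (nat \<Rightarrow> nat \<Rightarrow> real) \<Rightarrow> bool" where
  "RT_coeffs \<tau> a b c d \<longleftrightarrow> (\<forall>i<N. \<forall>j<N. AE x in lebesgue_on (cell h i j).
     \<tau> x = (a i j + b i j * fst x, c i j + d i j * snd x))"

lemma Sigma_h_RT_coeffs:
  assumes "\<tau> \<in> Sigma_h h" shows "\<exists>a b c d. RT_coeffs \<tau> a b c d"
proof -
  \<comment> \<open>The four coefficients are packed into one pair of pairs, so that a single choice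
    per cell fixes them together.\<close>
  define P where "P i j t \<longleftrightarrow> (AE x in lebesgue_on (cell h i j).
      \<tau> x = (fst (fst t) + snd (fst t) * fst x, fst (snd t) + snd (snd t) * snd x))" for i j t
  have ex: "\<exists>t. P i j t" if "i < N" "j < N" for i j
  proof -
    have "cell h i j \<in> uniform_mesh h" 
      unfolding uniform_mesh_eq mem_Collect_eq using that
      by (intro exI[of _ i] exI[of _ j] conjI refl)
    moreover have "\<forall>K\<in>uniform_mesh h.
        \<exists>p\<in>Q_poly 1 0. \<exists>q\<in>Q_poly 0 1. AE x in lebesgue_on K. \<tau> x = (p x, q x)"
      using assms by (simp add: Sigma_h_def)
    ultimately have "\<exists>p\<in>Q_poly 1 0. \<exists>q\<in>Q_poly 0 1.
        AE x in lebesgue_on (cell h i j). \<tau> x = (p x, q x)"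
      by (rule bspec[rotated])
    then obtain p q where p: "p \<in> Q_poly 1 0" and q: "q \<in> Q_poly 0 1"
      and ae: "AE x in lebesgue_on (cell h i j). \<tau> x = (p x, q x)"
      by (elim bexE)
    from p obtain c where "\<forall>x y. p (x, y) = (\<Sum>i\<le>1. \<Sum>j\<le>0. c i j * x ^ i * y ^ j)"
      unfolding Q_poly_def mem_Collect_eq by (elim exE)
    then have pc: "p z = c 0 0 + c 1 0 * fst z" for z by (cases z) simp
    from q obtain d where "\<forall>x y. q (x, y) = (\<Sum>i\<le>0. \<Sum>j\<le>1. d i j * x ^ i * y ^ j)"
      unfolding Q_poly_def mem_Collect_eq by (elim exE)
    then have qd: "q z = d 0 0 + d 0 1 * snd z" for z by (cases z) simp
    have "P i j ((c 0 0, c 1 0), (d 0 0, d 0 1))" using ae by (simp add: P_def pc qd)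
    then show ?thesis by (rule exI)
  qed
  define t where "t i j = (SOME t. P i j t)" for i j
  have "P i j (t i j)" if "i < N" "j < N" for i j
    unfolding t_def using ex[OF that] by (rule someI_ex)
  then have "RT_coeffs \<tau> (\<lambda>i j. fst (fst (t i j))) (\<lambda>i j. snd (fst (t i j)))
      (\<lambda>i j. fst (snd (t i j))) (\<lambda>i j. snd (snd (t i j)))"
    by (simp add: RT_coeffs_def P_def)
  then show ?thesis by (intro exI)
qed

text \<open>Green's formula on each cell, summed. Every interior edge occurs twice, with the trace
  from either side, so jumps of the normal component remain visible as coefficients of the edge
  integrals.\<close>

lemma RT_coeffs_green:
  assumes m: "\<tau> \<in> borel_measurable (lebesgue_on Omega)" and rt: "RT_coeffs \<tau> a b c d"
    and \<phi>: "\<phi> \<in> test_functions S"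
  shows "L2_inner Omega \<tau> (grad \<phi>) = (\<Sum>i<N. \<Sum>j<N.
     (a i j + b i j * (real (Suc i) * h)) * V_edge \<phi> (Suc i) j
     - (a i j + b i j * (real i * h)) * V_edge \<phi> i j
     + (c i j + d i j * (real (Suc j) * h)) * H_edge \<phi> i (Suc j)
     - (c i j + d i j * (real j * h)) * H_edge \<phi> i j
     - (b i j + d i j) * integral (cell h i j) \<phi>)"
proof -
  note D = test_function_derivs[OF \<phi>]
  let ?p = "partial_deriv (1, 0) \<phi>" and ?q = "partial_deriv (0, 1) \<phi>"
  let ?F = "\<lambda>i j z. (a i j + b i j * fst z) * ?p z + (c i j + d i j * snd z) * ?q z"
  have grad: "grad \<phi> = (\<lambda>z. (?p z, ?q z))" using D(6) by blast
  have "continuous_on UNIV (grad \<phi>)" unfolding grad by (intro continuous_on_Pair D)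
  then have mg: "grad \<phi> \<in> borel_measurable (lebesgue_on Omega)"
    by (intro borel_measurable_lebesgue_on borel_measurable_continuous_onI)
  have mF: "(\<lambda>z. \<tau> z \<bullet> grad \<phi> z) \<in> borel_measurable (lebesgue_on Omega)"
    using m mg by (rule borel_measurable_inner)
  have cF: "continuous_on T (?F i j)" for T i j
    by (intro continuous_intros D)
  have ae: "AE z in lebesgue_on (cell h i j). \<tau> z \<bullet> grad \<phi> z = ?F i j z" if "i < N" "j < N" for i j
  proof -
    have "AE x in lebesgue_on (cell h i j). \<tau> x = (a i j + b i j * fst x, c i j + d i j * snd x)"
      using rt that by (simp add: RT_coeffs_def)
    then show ?thesis by (rule AE_mp) (simp add: grad)
  qed
  have int: "integral (cell h i j) (?F i j) =
     (a i j + b i j * (real (Suc i) * h)) * V_edge \<phi> (Suc i) j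
     - (a i j + b i j * (real i * h)) * V_edge \<phi> i j
     + (c i j + d i j * (real (Suc j) * h)) * H_edge \<phi> i (Suc j)
     - (c i j + d i j * (real j * h)) * H_edge \<phi> i j
     - (b i j + d i j) * integral (cell h i j) \<phi>" for i j
  proof -
    have le: "real k * h \<le> real (Suc k) * h" for k using h_pos by simp
    have "integral (cell h i j) (?F i j) = integral (cell h i j) (\<lambda>z. (a i j + b i j * fst z) * ?p z)
        + integral (cell h i j) (\<lambda>z. (c i j + d i j * snd z) * ?q z)"
      unfolding cell_def
      by (intro integral_add integrable_continuous continuous_intros D)
    then show ?thesis
      unfolding V_edge_def H_edge_def cell_def
        integral_horizontal_parts[OF le D(4) D(1) D(2)] integral_vertical_parts[OF le D(5) D(1) D(3)]
      by (simp add: algebra_simps)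
  qed
  have "L2_inner Omega \<tau> (grad \<phi>) = (\<Sum>i<N. \<Sum>j<N. integral (cell h i j) (?F i j))"
    unfolding L2_inner_def by (rule Omega_integral_piecewise(2)[OF mF ae cF])
  then show ?thesis by (simp only: int)
qed

lemma content_cell: "measure lebesgue (cell h i j) = h\<^sup>2"
  using h_pos by (simp add: cell_def content_Pair algebra_simps power2_eq_square)

lemma integral_tensor_cell:
  fixes f g :: "real \<Rightarrow> real"
  assumes "continuous_on UNIV f" "continuous_on UNIV g"
  shows "integral (cell h i j) (\<lambda>z. f (fst z) * g (snd z)) =
    integral {real i * h..real (Suc i) * h} f * integral {real j * h..real (Suc j) * h} g"
  unfolding cell_def using assms by (rule integral_tensor)

text \<open>No node lies strictly inside a mesh interval. Hence a product of such bumps vanishes on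
  all grid lines, and all edge terms drop out of \<open>RT_coeffs_green\<close>.\<close>

lemma bump_node_eq_0: "r > 0 \<Longrightarrow> bump r (real I * h) (real (Suc I) * h) (real i * h) = 0"
  using node_less_iff[of I i] node_less_iff[of i "Suc I"] by (intro bump_eq_0) linarith+

lemma integral_bump_other_interval:
  assumes "r > 0" "i \<noteq> I"
  shows "integral {real i * h..real (Suc i) * h} (bump r (real I * h) (real (Suc I) * h)) = 0"
proof -
  have "bump r (real I * h) (real (Suc I) * h) x = 0"
    if "x \<in> {real i * h..real (Suc i) * h}" for x
  proof (rule bump_eq_0[OF assms(1)])
    have "real (Suc i) * h \<le> real I * h \<or> real (Suc I) * h \<le> real i * h"
      using assms(2) node_less_iff[of I "Suc i"] node_less_iff[of i "Suc I"] by linarith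
    then show "x \<le> real I * h \<or> real (Suc I) * h \<le> x" using that by auto
  qed
  then have "integral {real i * h..real (Suc i) * h} (bump r (real I * h) (real (Suc I) * h)) =
      integral {real i * h..real (Suc i) * h} (\<lambda>x. 0)"
    by (rule integral_cong)
  then show ?thesis by simp
qed

lemma nodes_interior:
  assumes "I < N" "r > 0"
  shows "0 < real I * h + 1 / r" "real (Suc I) * h - 1 / r < pi"
proof -
  have "0 \<le> real I * h" "1 / r > 0" using h_pos assms(2) by auto
  moreover have "real (Suc I) * h \<le> pi" using assms(1) by (simp only: node_le_pi_iff Suc_le_eq)
  ultimately show "0 < real I * h + 1 / r" "real (Suc I) * h - 1 / r < pi" by linarith+
qed

text \<open>Against bumps supported in one cell, Green's formula has area terms only, so
  \<open>g\<close> minus the cellwise divergence is orthogonal to them. Letting the bumps tend to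
  the indicator of the cell fixes the mean of \<open>g\<close>.\<close>

lemma cell_integral_weak_divergence:
  assumes \<tau>: "\<tau> \<in> borel_measurable (lebesgue_on Omega)" and rt: "RT_coeffs \<tau> a b c d"
    and g: "g \<in> L2_space Omega" and wd: "has_weak_divergence Omega \<tau> g"
    and IJ: "I < N" "J < N"
  shows "integral\<^sup>L (lebesgue_on (cell h I J)) g = (b I J + d I J) * h\<^sup>2"
proof -
  let ?D = "b I J + d I J"
  let ?f = "\<lambda>k. bump (real (Suc k)) (real I * h) (real (Suc I) * h)"
  let ?g = "\<lambda>k. bump (real (Suc k)) (real J * h) (real (Suc J) * h)"
  let ?\<phi> = "\<lambda>k z. ?f k (fst z) * ?g k (snd z)"
  let ?B = "box (real I * h, real J * h) (real (Suc I) * h, real (Suc J) * h)"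
  have ig: "integrable (lebesgue_on Omega) g"
    using g Omega_lmeasurable by (rule L2_space_integrable)
  have iD: "integrable (lebesgue_on Omega) (\<lambda>z. ?D)"
    using finite_measure_lebesgue_on[OF Omega_lmeasurable]
    by (simp add: finite_measure.integrable_const)
  have z: "(\<integral>z. (g z - ?D) * ?\<phi> k z \<partial>lebesgue_on Omega) = 0" for k
  proof -
    have pos: "real (Suc k) > 0" by simp
    have T: "?\<phi> k \<in> test_functions (interior Omega)"
      using IJ by (intro bump_product_test_function nodes_interior) auto
    have c: "continuous_on T (?\<phi> k)" for T by (rule continuous_on_bump_product)
    have V: "V_edge (?\<phi> k) i j = 0" "H_edge (?\<phi> k) i j = 0" for i j
      unfolding V_edge_def H_edge_def fst_conv snd_conv bump_node_eq_0[OF pos] by simp_all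
    \<comment> \<open>The bump has integral 0 over every other cell, so the coefficient there may be
      replaced by that of cell (I, J), which then factors out of the sum.\<close>
    have K: "(b i j + d i j) * integral (cell h i j) (?\<phi> k) = ?D * integral (cell h i j) (?\<phi> k)" for i j
      using integral_bump_other_interval[OF pos, of i I] integral_bump_other_interval[OF pos, of j J]
      unfolding integral_tensor_cell[OF continuous_on_bump continuous_on_bump]
      by (cases "i = I"; cases "j = J") simp_all
    have m\<phi>: "?\<phi> k \<in> borel_measurable (lebesgue_on Omega)"
      by (intro borel_measurable_lebesgue_on borel_measurable_continuous_onI c)
    have sum: "integral\<^sup>L (lebesgue_on Omega) (?\<phi> k) = (\<Sum>i<N. \<Sum>j<N. integral (cell h i j) (?\<phi> k))"
      by (rule Omega_integral_piecewise(2)[OF m\<phi>]) (rule AE_I2, rule refl, rule c)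
    have "- L2_inner Omega g (?\<phi> k) = L2_inner Omega \<tau> (grad (?\<phi> k))"
      using wd T by (simp only: has_weak_divergence_def)
    also have "\<dots> = - (?D * integral\<^sup>L (lebesgue_on Omega) (?\<phi> k))"
      unfolding RT_coeffs_green[OF \<tau> rt T] V K sum
      by (simp add: sum_negf sum_distrib_left)
    finally have "(\<integral>z. g z * ?\<phi> k z \<partial>lebesgue_on Omega) =
        (\<integral>z. ?D * ?\<phi> k z \<partial>lebesgue_on Omega)"
      by (simp add: L2_inner_def)
    moreover have "integrable (lebesgue_on Omega) (\<lambda>z. g z * ?\<phi> k z)"
      by (rule integrable_lebesgue_on_mult_bounded[OF Omega_sets ig c bump_product_le_1])
    moreover have "integrable (lebesgue_on Omega) (\<lambda>z. ?D * ?\<phi> k z)"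
      by (rule integrable_lebesgue_on_mult_bounded[OF Omega_sets iD c bump_product_le_1])
    ultimately show ?thesis
      by (simp only: left_diff_distrib Bochner_Integration.integral_diff)
  qed
  have lim: "(\<lambda>k. ?\<phi> k z) \<longlonglongrightarrow> indicator ?B z" for z
  proof -
    have "(\<lambda>k. ?\<phi> k z) \<longlonglongrightarrow> indicator {real I * h<..<real (Suc I) * h} (fst z)
        * indicator {real J * h<..<real (Suc J) * h} (snd z)"
      by (intro tendsto_mult LIMSEQ_Suc[OF bump_tendsto])
    then show ?thesis
      by (cases z) (auto simp: indicator_def box_Pair simp del: of_nat_Suc split: if_splits)
  qed
  have iB: "integrable (lebesgue_on Omega) (\<lambda>z. g z - ?D)"
    using ig iD by (rule Bochner_Integration.integrable_diff)
  have mB: "(indicator ?B :: real \<times> real \<Rightarrow> real) \<in> borel_measurable borel"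
    by (rule borel_measurable_indicator) simp
  have "(\<lambda>k. \<integral>z. (g z - ?D) * ?\<phi> k z \<partial>lebesgue_on Omega)
      \<longlonglongrightarrow> (\<integral>z. (g z - ?D) * indicator ?B z \<partial>lebesgue_on Omega)"
    by (rule tendsto_integral_bounded_mult[OF Omega_sets iB continuous_on_bump_product
          bump_product_le_1 mB]) (rule AE_I2, rule lim)
  from LIMSEQ_unique[OF this[unfolded z] tendsto_const]
  have 0: "(\<integral>z. (g z - ?D) * indicator ?B z \<partial>lebesgue_on Omega) = 0" .
  have iC: "integrable (lebesgue_on (cell h I J)) (\<lambda>z. g z - ?D)"
    using iB IJ by (rule integrable_on_cell)
  have "?B \<subseteq> cell h I J" unfolding cell_def by (rule box_subset_cbox)
  moreover have "cell h I J \<subseteq> Omega" using IJ by (rule cell_subset_Omega)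
  ultimately have sub: "?B \<subseteq> cell h I J" "cell h I J \<subseteq> Omega" .
  have "(\<integral>z. (g z - ?D) * indicator ?B z \<partial>lebesgue_on Omega) =
      (\<integral>z. indicator Omega z * ((g z - ?D) * indicator ?B z) \<partial>lebesgue)"
    using Omega_sets by (simp add: integral_restrict_space)
  \<comment> \<open>The limit indicator belongs to the open cell; the closed cell differs from it by
    its null frontier.\<close>
  also have "\<dots> = (\<integral>z. indicator (cell h I J) z * (g z - ?D) \<partial>lebesgue)"
  proof (rule integral_cong_AE)
    have m: "(\<lambda>z. indicator (cell h I J) z * (g z - ?D)) \<in> borel_measurable lebesgue"
      using borel_measurable_integrable[OF iC] cell_sets
      by (simp add: borel_measurable_restrict_space_iff)
    then show "(\<lambda>z. indicator (cell h I J) z * (g z - ?D)) \<in> borel_measurable lebesgue" .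
    have "(\<lambda>z. indicator ?B z * (indicator (cell h I J) z * (g z - ?D))) \<in> borel_measurable lebesgue"
      by (intro borel_measurable_times m borel_measurable_indicator) auto
    moreover have "(\<lambda>z. indicator ?B z * (indicator (cell h I J) z * (g z - ?D))) =
        (\<lambda>z. indicator Omega z * ((g z - ?D) * indicator ?B z))"
      using sub by (auto simp: fun_eq_iff indicator_def)
    ultimately show "(\<lambda>z. indicator Omega z * ((g z - ?D) * indicator ?B z)) \<in> borel_measurable lebesgue"
      by simp
    show "AE z in lebesgue. indicator Omega z * ((g z - ?D) * indicator ?B z) =
        indicator (cell h I J) z * (g z - ?D)"
      using AE_interior_cell[of h I J] by (rule AE_mp) (use sub in \<open>auto simp: indicator_def\<close>)
  qed
  also have "\<dots> = (\<integral>z. g z - ?D \<partial>lebesgue_on (cell h I J))"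
    using cell_sets by (simp add: integral_restrict_space)
  also have "\<dots> = integral\<^sup>L (lebesgue_on (cell h I J)) g - (\<integral>z. ?D \<partial>lebesgue_on (cell h I J))"
    by (rule Bochner_Integration.integral_diff[OF integrable_on_cell[OF ig IJ] integrable_on_cell[OF iD IJ]])
  also have "(\<integral>z. ?D \<partial>lebesgue_on (cell h I J)) = ?D * h\<^sup>2"
    by (simp add: measure_restrict_space cell_sets content_cell)
  finally show ?thesis using 0 by simp
qed

end

section \<open>Continuity of the normal component\<close>

text \<open>Half-width 2 / r minus the built-in shift 1 / r leaves a support of radius 1 / r around
  \<open>e\<close>.\<close>

lemma node_bump_nonzero_iff:
  assumes "r > 0"
  shows "bump r (e - 2 / r) (e + 2 / r) x \<noteq> 0 \<longleftrightarrow> \<bar>x - e\<bar> < 1 / r"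
proof -
  have "2 / r = 2 * (1 / r)" by simp
  then show ?thesis unfolding bump_pos_iff[OF assms] by linarith
qed

text \<open>At the centre both arguments of \<open>expinv\<close> equal 2 - 1 = 1 whatever
  \<open>r\<close> is: the bump shrinks to a line but keeps its height there.\<close>

lemma node_bump_center:
  assumes "r > 0" shows "bump r (e - 2 / r) (e + 2 / r) e = (expinv 0 1)\<^sup>2"
  using assms by (simp add: bump_def power2_eq_square)

lemma node_bump_tendsto_0:
  assumes "x \<noteq> e" "c > 0"
  shows "(\<lambda>k. bump (real k + c) (e - 2 / (real k + c)) (e + 2 / (real k + c)) x) \<longlonglongrightarrow> 0"
proof -
  have "filterlim (\<lambda>k. c + real k) at_top sequentially"
    by (rule filterlim_tendsto_add_at_top[OF tendsto_const filterlim_real_sequentially])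
  then have "(\<lambda>k. inverse (c + real k)) \<longlonglongrightarrow> 0"
    by (rule tendsto_inverse_0_at_top)
  then have "\<forall>\<^sub>F k in sequentially. inverse (c + real k) < \<bar>x - e\<bar>"
    by (rule order_tendstoD) (use assms(1) in simp)
  then have "\<forall>\<^sub>F k in sequentially.
      0 = bump (real k + c) (e - 2 / (real k + c)) (e + 2 / (real k + c)) x"
  proof (rule eventually_mono)
    fix k assume "inverse (c + real k) < \<bar>x - e\<bar>"
    then have "\<not> \<bar>x - e\<bar> < 1 / (real k + c)" by (simp add: inverse_eq_divide add.commute)
    then show "0 = bump (real k + c) (e - 2 / (real k + c)) (e + 2 / (real k + c)) x"
      using node_bump_nonzero_iff[of "real k + c" e x] assms(2) by force
  qed
  from Lim_transform_eventually[OF tendsto_const this] show ?thesis .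
qed

lemma AE_fst_neq: "AE z::real \<times> real in lebesgue. fst z \<noteq> e"
proof -
  have "negligible {z::real \<times> real. z \<bullet> (1, 0) = e}"
    by (rule negligible_standard_hyperplane) (simp add: Basis_real_prod)
  then have "{z::real \<times> real. fst z = e} \<in> null_sets lebesgue"
    by (simp add: negligible_iff_null_sets inner_prod_def)
  from AE_not_in[OF this] show ?thesis by simp
qed

lemma AE_snd_neq: "AE z::real \<times> real in lebesgue. snd z \<noteq> e"
proof -
  have "negligible {z::real \<times> real. z \<bullet> (0, 1) = e}"
    by (rule negligible_standard_hyperplane) (simp add: Basis_real_prod)
  then have "{z::real \<times> real. snd z = e} \<in> null_sets lebesgue"
    by (simp add: negligible_iff_null_sets inner_prod_def)
  from AE_not_in[OF this] show ?thesis by simp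
qed

lemma sum_delta2:
  fixes X :: "nat \<Rightarrow> nat \<Rightarrow> real"
  assumes "I < N" "J < N"
  shows "(\<Sum>i<N. \<Sum>j<N. X i j * (if i = I \<and> j = J then v else 0)) = X I J * v"
proof -
  have "(\<Sum>j<N. X i j * (if i = I \<and> j = J then v else 0)) = (if i = I then X i J * v else 0)" for i
    using assms(2) by (cases "i = I") (simp_all add: if_distrib[of "(*) _"] sum.delta cong: if_cong)
  then show ?thesis using assms(1) by (simp add: sum.delta)
qed

lemma telescoping_vanishing_ends:
  fixes R L :: "nat \<Rightarrow> real"
  assumes "\<And>i. Suc i < N \<Longrightarrow> R i = L (Suc i)" "R (N - 1) = 0" "L 0 = 0" "N > 0"
  shows "(\<Sum>i<N. R i - L i) = 0"
proof -
  \<comment> \<open>\<open>L N\<close> belongs to no interval. The value 0 put in its place agrees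
    with \<open>R (N - 1) = 0\<close>, so the last interval fits the telescope too.\<close>
  define M where "M i = (if i < N then L i else 0)" for i
  have "R i - L i = M (Suc i) - M i" if "i < N" for i
  proof (cases "Suc i < N")
    case True
    then show ?thesis using assms(1) that by (simp add: M_def)
  next
    case False
    then have "i = N - 1" using that by simp
    then show ?thesis using assms(2) that False by (simp add: M_def)
  qed
  then have "(\<Sum>i<N. R i - L i) = (\<Sum>i<N. M (Suc i) - M i)" by (intro sum.cong) auto
  also have "\<dots> = M N - M 0" by (rule sum_lessThan_telescope)
  finally show ?thesis using assms(3,4) by (simp add: M_def)
qed

context mesh begin

text \<open>In the lowest-order element the normal component is constant along an edge, so one
  equation per interior edge is full continuity. Tangential components may jump.\<close>

definition normal_continuous ::
    "(nat \<Rightarrow> nat \<Rightarrow> real) \<Rightarrow> (nat \<Rightarrow> nat \<Rightarrow> real) \<Rightarrow>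
     (nat \<Rightarrow> nat \<Rightarrow> real) \<Rightarrow> (nat \<Rightarrow> nat \<Rightarrow> real) \<Rightarrow> bool" where
  "normal_continuous a b c d \<longleftrightarrow>
     (\<forall>i j. Suc i < N \<longrightarrow> j < N \<longrightarrow>
        a i j + b i j * (real (Suc i) * h) = a (Suc i) j + b (Suc i) j * (real (Suc i) * h)) \<and>
     (\<forall>i j. i < N \<longrightarrow> Suc j < N \<longrightarrow>
        c i j + d i j * (real (Suc j) * h) = c i (Suc j) + d i (Suc j) * (real (Suc j) * h))"

text \<open>Test functions concentrating on an edge see only the jump of the normal component there.\<close>

lemma edge_fluxes_tendsto_0:
  assumes \<tau>: "\<tau> \<in> borel_measurable (lebesgue_on Omega)" and rt: "RT_coeffs \<tau> a b c d"
    and g: "g \<in> L2_space Omega" and wd: "has_weak_divergence Omega \<tau> g"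
    and T: "\<And>k. \<phi> k \<in> test_functions (interior Omega)"
    and B: "\<And>k z. \<bar>\<phi> k z\<bar> \<le> 1"
    and lim: "AE z in lebesgue. (\<lambda>k::nat. \<phi> k z) \<longlonglongrightarrow> 0"
  shows "(\<lambda>k. \<Sum>i<N. \<Sum>j<N.
     (a i j + b i j * (real (Suc i) * h)) * V_edge (\<phi> k) (Suc i) j
     - (a i j + b i j * (real i * h)) * V_edge (\<phi> k) i j
     + (c i j + d i j * (real (Suc j) * h)) * H_edge (\<phi> k) i (Suc j)
     - (c i j + d i j * (real j * h)) * H_edge (\<phi> k) i j) \<longlonglongrightarrow> 0"
    (is "(\<lambda>k. \<Sum>i<N. \<Sum>j<N. ?E k i j) \<longlonglongrightarrow> 0")
proof -
  note c = test_function_derivs(1)[OF T]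
  have "(\<lambda>k. integral (cell h i j) (\<phi> k)) \<longlonglongrightarrow> 0" for i j
  proof -
    have int: "integrable (lebesgue_on (cell h i j)) f" if "continuous_on UNIV f"
      for f :: "real \<times> real \<Rightarrow> real"
      unfolding cell_def using that
      by (intro continuous_imp_integrable continuous_on_subset[OF that]) simp
    have "(\<lambda>k. \<integral>z. 1 * \<phi> k z \<partial>lebesgue_on (cell h i j))
        \<longlonglongrightarrow> (\<integral>z. 1 * 0 \<partial>lebesgue_on (cell h i j))"
      by (rule tendsto_integral_bounded_mult[OF cell_sets int c B _ lim]) simp_all
    then show ?thesis
      by (simp add: lebesgue_integral_eq_integral[OF int[OF c] cell_sets])
  qed
  then have "(\<lambda>k. \<Sum>i<N. \<Sum>j<N. (b i j + d i j) * integral (cell h i j) (\<phi> k))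
      \<longlonglongrightarrow> (\<Sum>i<N. \<Sum>j<N. (b i j + d i j) * 0)"
    by (intro tendsto_sum tendsto_mult_left)
  moreover have "(\<lambda>k. L2_inner Omega g (\<phi> k)) \<longlonglongrightarrow> 0"
  proof -
    have "(\<lambda>k. \<integral>z. g z * \<phi> k z \<partial>lebesgue_on Omega) \<longlonglongrightarrow> (\<integral>z. g z * 0 \<partial>lebesgue_on Omega)"
      by (rule tendsto_integral_bounded_mult[OF Omega_sets
            L2_space_integrable[OF g Omega_lmeasurable] c B _ lim]) simp
    then show ?thesis by (simp add: L2_inner_def)
  qed
  ultimately have "(\<lambda>k. (\<Sum>i<N. \<Sum>j<N. (b i j + d i j) * integral (cell h i j) (\<phi> k))
      - L2_inner Omega g (\<phi> k)) \<longlonglongrightarrow> 0"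
    using tendsto_diff by fastforce
  moreover have "(\<Sum>i<N. \<Sum>j<N. ?E k i j) =
      (\<Sum>i<N. \<Sum>j<N. (b i j + d i j) * integral (cell h i j) (\<phi> k)) - L2_inner Omega g (\<phi> k)" for k
  proof -
    have "- L2_inner Omega g (\<phi> k) = L2_inner Omega \<tau> (grad (\<phi> k))"
      using wd T by (simp only: has_weak_divergence_def)
    also have "\<dots> = (\<Sum>i<N. \<Sum>j<N. ?E k i j)
        - (\<Sum>i<N. \<Sum>j<N. (b i j + d i j) * integral (cell h i j) (\<phi> k))"
      unfolding RT_coeffs_green[OF \<tau> rt T] by (simp only: sum_subtractf)
    finally show ?thesis by linarith
  qed
  ultimately show ?thesis by (simp only:)
qed

lemma node_distance: "i \<noteq> I \<Longrightarrow> h \<le> \<bar>real i * h - real I * h\<bar>"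
proof -
  assume "i \<noteq> I"
  then have "1 \<le> \<bar>real i - real I\<bar>" by linarith
  then have "1 * h \<le> \<bar>real i - real I\<bar> * h" using h_pos by (intro mult_right_mono) auto
  also have "\<dots> = \<bar>(real i - real I) * h\<bar>" using h_pos by (simp add: abs_mult)
  finally show ?thesis by (simp add: left_diff_distrib)
qed

lemma node_bump_at_node:
  assumes "r > 0" "1 / r < h"
  shows "bump r (real I * h - 2 / r) (real I * h + 2 / r) (real i * h) =
    (if i = I then (expinv 0 1)\<^sup>2 else 0)"
proof (cases "i = I")
  case True
  then show ?thesis using node_bump_center[OF assms(1)] by simp
next
  case False
  then show ?thesis
    using node_bump_nonzero_iff[OF assms(1), of "real I * h" "real i * h"] node_distance[OF False] assms(2)
    by auto
qed

lemma node_bump_interior: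
  assumes "Suc I < N" "r > 0" "1 / r < h"
  shows "0 < (real (Suc I) * h - 2 / r) + 1 / r" "(real (Suc I) * h + 2 / r) - 1 / r < pi"
proof -
  have "2 / r = 2 * (1 / r)" by simp
  moreover have "h \<le> real (Suc I) * h" "real (Suc (Suc I)) * h = real (Suc I) * h + h"
    using h_pos by (simp_all add: algebra_simps)
  moreover have "real (Suc (Suc I)) * h \<le> pi" using assms(1) by (simp only: node_le_pi_iff Suc_le_eq)
  ultimately show "0 < (real (Suc I) * h - 2 / r) + 1 / r" "(real (Suc I) * h + 2 / r) - 1 / r < pi"
    using assms(3) by linarith+
qed

text \<open>The height of a node bump on its centre line does not depend on its sharpness, so the
  sums in \<open>edge_fluxes_tendsto_0\<close> form a constant sequence; since it tends to 0, the
  jump across the chosen edge vanishes.\<close>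

lemma weak_divergence_normal_continuous:
  assumes \<tau>: "\<tau> \<in> borel_measurable (lebesgue_on Omega)" and rt: "RT_coeffs \<tau> a b c d"
    and g: "g \<in> L2_space Omega" and wd: "has_weak_divergence Omega \<tau> g"
  shows "normal_continuous a b c d"
proof -
  \<comment> \<open>The offset 2 / h gives 1 / r < h from k = 0 on: the support around an interior
    node then contains no other node and stays inside the domain.\<close>
  define r where "r k = real k + 2 / h" for k
  have r: "r k > 0" "1 / r k < h" for k
  proof -
    have "2 / h > 0" using h_pos by simp
    then show "r k > 0" unfolding r_def by (rule add_nonneg_pos[OF of_nat_0_le_iff])
    have "h * r k = h * real k + 2" using h_pos by (simp add: r_def distrib_left)
    moreover have "h * real k \<ge> 0" using h_pos by simp
    ultimately show "1 / r k < h" using \<open>r k > 0\<close> by (simp add: divide_less_eq)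
  qed
  let ?w = "(expinv 0 1)\<^sup>2"
  have w: "?w \<noteq> 0" by (simp add: expinv_def)
  have h4: "4 / h > 0" using h_pos by simp
  let ?n = "\<lambda>I k. bump (r k) (real (Suc I) * h - 2 / r k) (real (Suc I) * h + 2 / r k)"
  \<comment> \<open>Along the edge the bump is fixed and supported in the middle half, away from
    both end nodes; this removes the edges perpendicular to the chosen one.\<close>
  let ?s = "\<lambda>J. bump (4 / h) (real J * h) (real (Suc J) * h)"
  have S: "integral {real j * h..real (Suc j) * h} (?s J) \<noteq> 0 \<longleftrightarrow> j = J" for j J
  proof (cases "j = J")
    case True
    have "real (Suc J) * h - real J * h = h" by (simp add: algebra_simps)
    then show ?thesis using integral_bump_pos[of "real J * h" "real (Suc J) * h"] h_pos True by simp
  next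
    case False
    then show ?thesis using integral_bump_other_interval[OF h4 False] by simp
  qed
  have vert: "a I J + b I J * (real (Suc I) * h) = a (Suc I) J + b (Suc I) J * (real (Suc I) * h)"
    if I: "Suc I < N" and J: "J < N" for I J
  proof -
    let ?\<phi> = "\<lambda>k z. ?n I k (fst z) * ?s J (snd z)"
    let ?\<Psi> = "integral {real J * h..real (Suc J) * h} (?s J)"
    have T: "?\<phi> k \<in> test_functions (interior Omega)" for k
      by (intro bump_product_test_function node_bump_interior I r nodes_interior J h4)
    have V: "V_edge (?\<phi> k) i j = (if i = Suc I \<and> j = J then ?w * ?\<Psi> else 0)" for k i j
      using S[of j J] unfolding V_edge_def fst_conv snd_conv node_bump_at_node[OF r]
      by (cases "i = Suc I"; cases "j = J") (simp_all del: of_nat_Suc)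
    have H: "H_edge (?\<phi> k) i j = 0" for k i j
      unfolding H_edge_def fst_conv snd_conv bump_node_eq_0[OF h4] by simp
    have lim: "AE z in lebesgue. (\<lambda>k. ?\<phi> k z) \<longlonglongrightarrow> 0"
      using AE_fst_neq[of "real (Suc I) * h"]
    proof (rule AE_mp, intro AE_I2 impI)
      fix z :: "real \<times> real" assume "fst z \<noteq> real (Suc I) * h"
      then have "(\<lambda>k. ?n I k (fst z)) \<longlonglongrightarrow> 0"
        unfolding r_def using h_pos by (intro node_bump_tendsto_0) simp_all
      then show "(\<lambda>k. ?\<phi> k z) \<longlonglongrightarrow> 0" by (rule tendsto_mult_left_zero)
    qed
    note E = edge_fluxes_tendsto_0[OF \<tau> rt g wd T bump_product_le_1 lim]
    \<comment> \<open>Only the edge (Suc I, J) survives. It is the right edge of cell (I, J) and the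
      left edge of cell (Suc I, J), hence the two terms of opposite sign.\<close>
    have "(a I J + b I J * (real (Suc I) * h)) * (?w * ?\<Psi>)
        - (a (Suc I) J + b (Suc I) J * (real (Suc I) * h)) * (?w * ?\<Psi>) = 0"
      using E unfolding V H nat.inject
      by (simp only: sum.distrib sum_subtractf mult_zero_right sum_delta2 J I Suc_lessD
          sum.neutral_const add_0_right diff_0_right LIMSEQ_const_iff)
    then show ?thesis using w S[of J J] by (simp flip: left_diff_distrib)
  qed
  have hor: "c I J + d I J * (real (Suc J) * h) = c I (Suc J) + d I (Suc J) * (real (Suc J) * h)"
    if I: "I < N" and J: "Suc J < N" for I J
  proof -
    let ?\<phi> = "\<lambda>k z. ?s I (fst z) * ?n J k (snd z)"
    let ?\<Psi> = "integral {real I * h..real (Suc I) * h} (?s I)"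
    have T: "?\<phi> k \<in> test_functions (interior Omega)" for k
      by (intro bump_product_test_function node_bump_interior J r nodes_interior I h4)
    have H: "H_edge (?\<phi> k) i j = (if i = I \<and> j = Suc J then ?w * ?\<Psi> else 0)" for k i j
      using S[of i I] unfolding H_edge_def fst_conv snd_conv node_bump_at_node[OF r]
      by (cases "i = I"; cases "j = Suc J") (simp_all del: of_nat_Suc)
    have V: "V_edge (?\<phi> k) i j = 0" for k i j
      unfolding V_edge_def fst_conv snd_conv bump_node_eq_0[OF h4] by simp
    have lim: "AE z in lebesgue. (\<lambda>k. ?\<phi> k z) \<longlonglongrightarrow> 0"
      using AE_snd_neq[of "real (Suc J) * h"]
    proof (rule AE_mp, intro AE_I2 impI)
      fix z :: "real \<times> real" assume "snd z \<noteq> real (Suc J) * h"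
      then have "(\<lambda>k. ?n J k (snd z)) \<longlonglongrightarrow> 0"
        unfolding r_def using h_pos by (intro node_bump_tendsto_0) simp_all
      then show "(\<lambda>k. ?\<phi> k z) \<longlonglongrightarrow> 0" by (rule tendsto_mult_right_zero)
    qed
    note E = edge_fluxes_tendsto_0[OF \<tau> rt g wd T bump_product_le_1 lim]
    have "(c I J + d I J * (real (Suc J) * h)) * (?w * ?\<Psi>)
        - (c I (Suc J) + d I (Suc J) * (real (Suc J) * h)) * (?w * ?\<Psi>) = 0"
      using E unfolding V H nat.inject
      by (simp only: sum.distrib sum_subtractf mult_zero_right sum_delta2 J I Suc_lessD
          sum.neutral_const add_0 diff_0_right LIMSEQ_const_iff)
    then show ?thesis using w S[of I I] by (simp flip: left_diff_distrib)
  qed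
  show ?thesis unfolding normal_continuous_def by (intro conjI allI impI vert hor)
qed

text \<open>Converse direction, used to place the discrete flux in \<open>Hdiv\<close>: interior
  edge terms cancel by continuity of the normal component, and boundary edges contribute nothing
  because test functions vanish there.\<close>

lemma normal_continuous_weak_divergence:
  assumes \<tau>: "\<tau> \<in> borel_measurable (lebesgue_on Omega)" and rt: "RT_coeffs \<tau> a b c d"
    and nc: "normal_continuous a b c d"
    and g: "g \<in> borel_measurable (lebesgue_on Omega)"
    and gD: "\<And>i j. i < N \<Longrightarrow> j < N \<Longrightarrow> AE z in lebesgue_on (cell h i j). g z = b i j + d i j"
  shows "has_weak_divergence Omega \<tau> g"
  unfolding has_weak_divergence_def
proof
  fix \<phi> :: "real \<times> real \<Rightarrow> real"
  assume T: "\<phi> \<in> test_functions (interior Omega)"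
  note D = test_function_derivs[OF T]
  have bd: "\<phi> (x, y) = 0" if "x = 0 \<or> x = pi \<or> y = 0 \<or> y = pi" for x y
    by (rule D(7)) (use that in \<open>auto simp: interior_Omega\<close>)
  have m: "\<phi> \<in> borel_measurable (lebesgue_on Omega)"
    by (intro borel_measurable_lebesgue_on borel_measurable_continuous_onI D)
  have "L2_inner Omega g \<phi> = (\<Sum>i<N. \<Sum>j<N. integral (cell h i j) (\<lambda>z. (b i j + d i j) * \<phi> z))"
    unfolding L2_inner_def inner_real_def
  proof (rule Omega_integral_piecewise(2)[OF borel_measurable_times[OF g m]])
    fix i j assume "i < N" "j < N"
    from gD[OF this] show "AE z in lebesgue_on (cell h i j). g z * \<phi> z = (b i j + d i j) * \<phi> z"
      by (rule AE_mp) simp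
  qed (intro continuous_intros D)
  then have gphi: "L2_inner Omega g \<phi> = (\<Sum>i<N. \<Sum>j<N. (b i j + d i j) * integral (cell h i j) \<phi>)"
    by simp
  let ?RV = "\<lambda>i j. (a i j + b i j * (real (Suc i) * h)) * V_edge \<phi> (Suc i) j"
  let ?LV = "\<lambda>i j. (a i j + b i j * (real i * h)) * V_edge \<phi> i j"
  let ?RH = "\<lambda>i j. (c i j + d i j * (real (Suc j) * h)) * H_edge \<phi> i (Suc j)"
  let ?LH = "\<lambda>i j. (c i j + d i j * (real j * h)) * H_edge \<phi> i j"
  have V0: "V_edge \<phi> 0 j = 0" "V_edge \<phi> N j = 0" "H_edge \<phi> j 0 = 0" "H_edge \<phi> j N = 0" for j
    by (simp_all add: V_edge_def H_edge_def bd N_h)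
  have SN: "Suc (N - 1) = N" using N_pos by simp
  have v: "(\<Sum>i<N. ?RV i j - ?LV i j) = 0" if "j < N" for j
  proof (rule telescoping_vanishing_ends)
    show "?RV i j = ?LV (Suc i) j" if "Suc i < N" for i
      using nc that \<open>j < N\<close> by (simp only: normal_continuous_def)
    show "?RV (N - 1) j = 0" by (simp only: SN V0 mult_zero_right)
  qed (simp_all add: V0 N_pos)
  have hh: "(\<Sum>j<N. ?RH i j - ?LH i j) = 0" if "i < N" for i
  proof (rule telescoping_vanishing_ends)
    show "?RH i j = ?LH i (Suc j)" if "Suc j < N" for j
      using nc that \<open>i < N\<close> by (simp only: normal_continuous_def)
    show "?RH i (N - 1) = 0" by (simp only: SN V0 mult_zero_right)
  qed (simp_all add: V0 N_pos)
  have "L2_inner Omega \<tau> (grad \<phi>) = (\<Sum>i<N. \<Sum>j<N. (?RV i j - ?LV i j) + (?RH i j - ?LH i j)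
      - (b i j + d i j) * integral (cell h i j) \<phi>)"
    unfolding RT_coeffs_green[OF \<tau> rt T] by (simp only: add_diff_eq)
  also have "\<dots> = (\<Sum>i<N. \<Sum>j<N. ?RV i j - ?LV i j) + (\<Sum>i<N. \<Sum>j<N. ?RH i j - ?LH i j)
      - L2_inner Omega g \<phi>"
    unfolding gphi by (simp only: sum.distrib sum_subtractf)
  \<comment> \<open>Fluxes through vertical edges telescope in i for fixed j, so the sum over i has
    to be the inner one.\<close>
  also have "(\<Sum>i<N. \<Sum>j<N. ?RV i j - ?LV i j) = (\<Sum>j<N. \<Sum>i<N. ?RV i j - ?LV i j)"
    by (rule sum.swap)
  also have "\<dots> = 0" by (rule sum.neutral) (use v in blast)
  also have "(\<Sum>i<N. \<Sum>j<N. ?RH i j - ?LH i j) = 0" by (rule sum.neutral) (use hh in blast)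
  finally show "L2_inner Omega \<tau> (grad \<phi>) = - L2_inner Omega g \<phi>" by simp
qed

text \<open>A cellwise constant sees nothing of \<open>g\<close> but its cell means, which is what
  \<open>cell_integral_weak_divergence\<close> provides for a divergence.\<close>

lemma integral_mult_cellwise_const:
  fixes g v :: "real \<times> real \<Rightarrow> real"
  assumes g: "integrable (lebesgue_on Omega) g" and v: "v \<in> borel_measurable (lebesgue_on Omega)"
    and w: "\<And>i j. i < N \<Longrightarrow> j < N \<Longrightarrow> AE z in lebesgue_on (cell h i j). v z = w i j"
  shows "(\<integral>z. g z * v z \<partial>lebesgue_on Omega) =
    (\<Sum>i<N. \<Sum>j<N. w i j * integral\<^sup>L (lebesgue_on (cell h i j)) g)"
proof -
  have *: "integrable (lebesgue_on (cell h i j)) (\<lambda>z. g z * v z) \<and>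
      (\<integral>z. g z * v z \<partial>lebesgue_on (cell h i j)) = w i j * integral\<^sup>L (lebesgue_on (cell h i j)) g"
    if ij: "i < N" "j < N" for i j
  proof -
    note gi = integrable_on_cell[OF g ij]
    have m1: "(\<lambda>z. g z * v z) \<in> borel_measurable (lebesgue_on (cell h i j))"
      by (rule borel_measurable_times[OF borel_measurable_integrable[OF gi] measurable_on_cell[OF v ij]])
    have int: "integrable (lebesgue_on (cell h i j)) (\<lambda>z. g z * w i j)"
      using gi by (rule integrable_mult_left)
    note m2 = borel_measurable_integrable[OF int]
    have ae: "AE z in lebesgue_on (cell h i j). g z * v z = g z * w i j"
      using w[OF ij] by (rule AE_mp) simp
    show ?thesis
      using integrable_cong_AE[OF m1 m2 ae] integral_cong_AE[OF m1 m2 ae] int by simp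
  qed
  show ?thesis using * by (subst cells_integral(2)) auto
qed

end

section \<open>The discrete eigenfunctions\<close>

text \<open>The weights 2, 1, 1, 2 over 6 form the local mass matrix of linear elements. End values
  replace coefficients because they are what neighbouring cells share.\<close>

lemma integral_affine_product:
  fixes p q :: real
  assumes "p \<le> q"
  shows "integral {p..q} (\<lambda>x. (a + b * x) * (a' + b' * x)) = (q - p) / 6 *
    (2 * (a + b * p) * (a' + b' * p) + (a + b * p) * (a' + b' * q)
     + (a + b * q) * (a' + b' * p) + 2 * (a + b * q) * (a' + b' * q))"
proof -
  define A where "A x = a * a' * x + (a * b' + b * a') * x\<^sup>2 / 2 + b * b' * x ^ 3 / 3" for x
  have "((\<lambda>x. (a + b * x) * (a' + b' * x)) has_integral (A q - A p)) {p..q}"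
  proof (rule fundamental_theorem_of_calculus[OF assms])
    fix x
    have "(A has_real_derivative (a + b * x) * (a' + b' * x)) (at x)"
      unfolding A_def by (auto intro!: derivative_eq_intros simp: algebra_simps power2_eq_square)
    then show "(A has_vector_derivative (a + b * x) * (a' + b' * x)) (at x within {p..q})"
      using has_real_derivative_iff_has_vector_derivative has_vector_derivative_at_within by blast
  qed
  then have "integral {p..q} (\<lambda>x. (a + b * x) * (a' + b' * x)) = A q - A p"
    by (rule integral_unique)
  also have "\<dots> = (q - p) / 6 *
    (2 * (a + b * p) * (a' + b' * p) + (a + b * p) * (a' + b' * q)
     + (a + b * q) * (a' + b' * p) + 2 * (a + b * q) * (a' + b' * q))"
    by (simp add: A_def field_simps power2_eq_square power3_eq_cube)
  finally show ?thesis .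
qed

text \<open>A floor keeps the discrete functions globally defined and Borel. Grid lines go to the
  cell on their right or above, and the lines at pi to the nonexistent index \<open>N\<close>; both
  are null sets.\<close>

definition cell_index :: "real \<Rightarrow> real \<Rightarrow> nat" where
  "cell_index h x = nat \<lfloor>x / h\<rfloor>"

definition mode :: "real \<Rightarrow> nat \<Rightarrow> nat \<Rightarrow> real" where
  "mode h p i = sin (real p * (real i + 1 / 2) * h)"

text \<open>The factor in front of the cosine solves the equation of the one-dimensional mass matrix with
  stencil \<open>h/6 (1, 4, 1)\<close>, whose symbol at frequency \<open>p\<close> is \<open>h (2 + cos (p h)) / 3\<close>.\<close>

definition mode_flux :: "real \<Rightarrow> nat \<Rightarrow> nat \<Rightarrow> real" where
  "mode_flux h p i = - 6 * sin (real p * h / 2) / (h * (2 + cos (real p * h))) * cos (real p * real i * h)"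

text \<open>The quotient of the stiffness symbol 2 (1 - cos(p h)) / h by the mass symbol h (2 +
  cos(p h)) / 3: the eigenvalue of one-dimensional linear elements with consistent mass
  matrix.\<close>

definition mode_eigenvalue :: "real \<Rightarrow> nat \<Rightarrow> real" where
  "mode_eigenvalue h p = 6 * (1 - cos (real p * h)) / (h\<^sup>2 * (2 + cos (real p * h)))"

definition discrete_u :: "real \<Rightarrow> nat \<Rightarrow> nat \<Rightarrow> real \<times> real \<Rightarrow> real" where
  "discrete_u h m n z = mode h m (cell_index h (fst z)) * mode h n (cell_index h (snd z))"

text \<open>The slope is chosen so that the cellwise divergence is the eigenvalue times the scalar
  by construction. That the pieces then join continuously is \<open>affine_flux_Suc\<close>.\<close>

definition affine_flux :: "real \<Rightarrow> nat \<Rightarrow> nat \<Rightarrow> real \<Rightarrow> real" where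
  "affine_flux h p i x = mode_flux h p i + mode_eigenvalue h p * mode h p i * (x - real i * h)"

definition discrete_sigma :: "real \<Rightarrow> nat \<Rightarrow> nat \<Rightarrow> real \<times> real \<Rightarrow> real \<times> real" where
  "discrete_sigma h m n z =
    (affine_flux h m (cell_index h (fst z)) (fst z) * mode h n (cell_index h (snd z)),
     affine_flux h n (cell_index h (snd z)) (snd z) * mode h m (cell_index h (fst z)))"

lemma two_plus_cos_pos: "2 + cos (x::real) > 0"
  using cos_ge_minus_one[of x] by linarith

text \<open>The difference of consecutive cosines is -2 sin((i + 1/2) t) sin(t / 2) with t = p h, a
  multiple of \<open>mode\<close>; 1 - cos t = 2 sin(t / 2)^2 matches the factor.\<close>

lemma affine_flux_Suc:
  assumes "h > 0"
  shows "affine_flux h p i (real (Suc i) * h) = mode_flux h p (Suc i)"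
proof -
  define \<theta> where "\<theta> = real p * h"
  define D where "D = 2 + cos \<theta>"
  have D: "D \<noteq> 0" using two_plus_cos_pos[of \<theta>] by (simp add: D_def)
  have half: "real (Suc i) * \<theta> = (real i + 1 / 2) * \<theta> + \<theta> / 2"
    "real i * \<theta> = (real i + 1 / 2) * \<theta> - \<theta> / 2"
    by (simp_all add: algebra_simps)
  have c: "cos (real (Suc i) * \<theta>) = cos (real i * \<theta>) - 2 * sin ((real i + 1 / 2) * \<theta>) * sin (\<theta> / 2)"
    unfolding half cos_add cos_diff by simp
  have k: "1 - cos \<theta> = 2 * (sin (\<theta> / 2))\<^sup>2" using cos_double_sin[of "\<theta> / 2"] by simp
  have e: "real p * (real k) * h = real k * \<theta>" "real p * (real i + 1 / 2) * h = (real i + 1 / 2) * \<theta>"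
    "real p * h = \<theta>" "real p * h / 2 = \<theta> / 2" for k
    by (simp_all add: \<theta>_def)
  show ?thesis
    unfolding affine_flux_def mode_flux_def mode_eigenvalue_def mode_def e c D_def[symmetric] k
    using assms D by (simp add: field_simps power2_eq_square)
qed

text \<open>The right-hand side telescopes along a row of cells once \<open>R\<close> is the left trace of the next cell,
  and the sines vanish at both ends of the row.\<close>

lemma mode_row_identity:
  fixes h L R :: real and p i :: nat
  defines "\<theta> \<equiv> real p * h"
  defines "\<kappa> \<equiv> cos (\<theta> / 2) + sin (\<theta> / 2) * sin \<theta> / (2 + cos \<theta>)"
  assumes h: "h > 0"
  shows "h\<^sup>2 / 6 * (2 * mode_flux h p i * L + mode_flux h p i * R
       + mode_flux h p (Suc i) * L + 2 * mode_flux h p (Suc i) * R) - h * (R - L) * mode h p i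
    = - \<kappa> * h * sin (real (Suc i) * \<theta>) * R - (- \<kappa> * h * sin (real i * \<theta>) * L)"
proof -
  define D where "D = 2 + cos \<theta>"
  have D: "D \<noteq> 0" using two_plus_cos_pos[of \<theta>] by (simp add: D_def)
  define s where "s = sin (\<theta> / 2)"
  define t where "t = cos (\<theta> / 2)"
  define C where "C = cos (real i * \<theta>)"
  define S where "S = sin (real i * \<theta>)"
  define C' where "C' = cos (real (Suc i) * \<theta>)"
  define S' where "S' = sin (real (Suc i) * \<theta>)"
  have st: "s\<^sup>2 + t\<^sup>2 = 1" by (simp add: s_def t_def)
  have a1: "real (Suc i) * \<theta> = real i * \<theta> + \<theta>" by (simp add: algebra_simps)
  have a2: "(real i + 1 / 2) * \<theta> = real i * \<theta> + \<theta> / 2" by (simp add: algebra_simps)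
  have a3: "(real i + 1 / 2) * \<theta> = real (Suc i) * \<theta> - \<theta> / 2" by (simp add: algebra_simps)
  have a4: "real i * \<theta> = real (Suc i) * \<theta> - \<theta>" by (simp add: algebra_simps)
  have C': "C' = C * cos \<theta> - S * sin \<theta>" unfolding C'_def C_def S_def a1 by (rule cos_add)
  have C: "C = C' * cos \<theta> + S' * sin \<theta>" unfolding C'_def C_def S'_def a4 by (rule cos_diff)
  \<comment> \<open>The midpoint sine is expanded from the left node here and from the right node in
    \<open>m2\<close>, since the factors of \<open>L\<close> and \<open>R\<close> are to involve
    only their own node.\<close>
  have m1: "mode h p i = S * t + C * s"
  proof -
    have "mode h p i = sin ((real i + 1 / 2) * \<theta>)" by (simp add: mode_def \<theta>_def mult.assoc mult.left_commute mult.commute)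
    then show ?thesis unfolding a2 sin_add C_def S_def s_def t_def .
  qed
  have m2: "mode h p i = S' * t - C' * s"
  proof -
    have "mode h p i = sin ((real i + 1 / 2) * \<theta>)" by (simp add: mode_def \<theta>_def mult.assoc mult.left_commute mult.commute)
    then show ?thesis unfolding a3 sin_diff C'_def S'_def s_def t_def .
  qed
  have F: "mode_flux h p i = - 6 * s / (h * D) * C" "mode_flux h p (Suc i) = - 6 * s / (h * D) * C'"
    unfolding mode_flux_def s_def D_def C_def C'_def \<theta>_def by (simp_all only: mult.assoc mult.left_commute mult.commute)
  \<comment> \<open>Splitting off a multiple of \<open>D\<close> makes the cosine terms cancel those
    of the midpoint sine. Only nodal sines remain, and these vanish at the ends of a row.\<close>
  have L: "(2 * C + C') = C * D - S * sin \<theta>" unfolding C' D_def by (simp add: algebra_simps)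
  have R: "(C + 2 * C') = C' * D + S' * sin \<theta>" unfolding C D_def by (simp add: algebra_simps)
  have "h\<^sup>2 / 6 * (2 * mode_flux h p i * L + mode_flux h p i * R
       + mode_flux h p (Suc i) * L + 2 * mode_flux h p (Suc i) * R) - h * (R - L) * mode h p i
     = - s * h / D * ((2 * C + C') * L + (C + 2 * C') * R) - h * R * mode h p i + h * L * mode h p i"
    unfolding F using h D by (simp add: field_simps power2_eq_square)
  also have "\<dots> = - s * h / D * ((C * D - S * sin \<theta>) * L + (C' * D + S' * sin \<theta>) * R)
      - h * R * (S' * t - C' * s) + h * L * (S * t + C * s)"
    unfolding L R using m1 m2 by (simp only:)
  also have "\<dots> = - (t + s * sin \<theta> / D) * h * S' * R - (- (t + s * sin \<theta> / D) * h * S * L)"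
    using D by (simp add: field_simps)
  finally show ?thesis unfolding \<kappa>_def S_def S'_def s_def t_def D_def .
qed

text \<open>The map factors through the countable discrete space of floor values, so an arbitrary
  \<open>F\<close> is admissible.\<close>

lemma cell_index_measurable:
  assumes "f \<in> borel_measurable borel"
  shows "(\<lambda>z::real \<times> real. F (cell_index h (f z)) :: real) \<in> borel_measurable borel"
proof -
  have "(\<lambda>z. f z / h) \<in> borel_measurable borel" using assms by simp
  then have "(\<lambda>z. \<lfloor>f z / h\<rfloor>) \<in> borel \<rightarrow>\<^sub>M count_space UNIV"
    by (rule measurable_compose[OF _ measurable_real_floor])
  then have "(\<lambda>z. F (nat \<lfloor>f z / h\<rfloor>)) \<in> borel_measurable borel"
    by (rule measurable_compose) simp
  then show ?thesis by (simp only: cell_index_def)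
qed

lemma borel_measurable_fst_snd:
  "(fst :: real \<times> real \<Rightarrow> real) \<in> borel_measurable borel"
  "(snd :: real \<times> real \<Rightarrow> real) \<in> borel_measurable borel"
  by (auto intro!: borel_measurable_continuous_onI continuous_intros)

lemma discrete_u_measurable: "discrete_u h m n \<in> borel_measurable borel"
  unfolding discrete_u_def[abs_def]
  by (intro borel_measurable_times cell_index_measurable borel_measurable_fst_snd)

lemma discrete_sigma_measurable: "discrete_sigma h m n \<in> borel_measurable borel"
  unfolding discrete_sigma_def[abs_def] affine_flux_def
  by (intro borel_measurable_Pair borel_measurable_times borel_measurable_add borel_measurable_diff
      cell_index_measurable[where F="\<lambda>i. real i * h"]
      cell_index_measurable[where F="mode h p" for p]
      cell_index_measurable[where F="mode_flux h p" for p]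
      cell_index_measurable[where F="\<lambda>i. real i"]
      borel_measurable_fst_snd borel_measurable_const)

section \<open>The discrete pair lies in the discrete spaces\<close>

context mesh begin

lemma cell_index_eq:
  assumes "real i * h < x" "x < real (Suc i) * h"
  shows "cell_index h x = i"
proof -
  have "real i < x / h" "x / h < real i + 1"
    using assms h_pos by (auto simp: field_simps)
  then have "\<lfloor>x / h\<rfloor> = int i" by (intro floor_unique) auto
  then show ?thesis by (simp add: cell_index_def)
qed

lemma AE_cell_index:
  "AE z in lebesgue_on (cell h i j). cell_index h (fst z) = i \<and> cell_index h (snd z) = j"
proof -
  have "AE z in lebesgue. z \<in> cell h i j \<longrightarrow> cell_index h (fst z) = i \<and> cell_index h (snd z) = j"
    using AE_interior_cell[of h i j]
  proof (rule AE_mp, intro AE_I2 impI)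
    fix z assume "z \<in> cell h i j \<longrightarrow>
        z \<in> box (real i * h, real j * h) (real (Suc i) * h, real (Suc j) * h)" "z \<in> cell h i j"
    then have "(fst z, snd z) \<in> box (real i * h, real j * h) (real (Suc i) * h, real (Suc j) * h)"
      by simp
    then show "cell_index h (fst z) = i \<and> cell_index h (snd z) = j"
      unfolding box_Pair by (intro conjI cell_index_eq) blast+
  qed
  moreover have "cell h i j \<inter> space lebesgue \<in> sets lebesgue" by (simp add: cell_sets)
  ultimately show ?thesis by (simp only: AE_restrict_space_iff)
qed

lemma discrete_u_cell: "AE z in lebesgue_on (cell h i j). discrete_u h m n z = mode h m i * mode h n j"
  using AE_cell_index by (rule AE_mp) (simp add: discrete_u_def)

text \<open>Coefficients of the first component. Those of the second arise by exchanging m with n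
  and i with j.\<close>

definition sigma_a where
  "sigma_a m n i j = (mode_flux h m i - mode_eigenvalue h m * mode h m i * (real i * h)) * mode h n j"
definition sigma_b where
  "sigma_b m n i j = mode_eigenvalue h m * mode h m i * mode h n j"

lemma affine_flux_coeffs: "affine_flux h m i x * mode h n j = sigma_a m n i j + sigma_b m n i j * x"
  by (simp add: affine_flux_def sigma_a_def sigma_b_def algebra_simps)

lemma RT_coeffs_discrete_sigma:
  "RT_coeffs (discrete_sigma h m n) (sigma_a m n) (sigma_b m n)
     (\<lambda>i j. sigma_a n m j i) (\<lambda>i j. sigma_b n m j i)"
  unfolding RT_coeffs_def
proof (intro allI impI)
  fix i j
  show "AE x in lebesgue_on (cell h i j). discrete_sigma h m n x =
      (sigma_a m n i j + sigma_b m n i j * fst x, sigma_a n m j i + sigma_b n m j i * snd x)"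
    using AE_cell_index by (rule AE_mp) (simp add: discrete_sigma_def affine_flux_coeffs)
qed

lemma sigma_left: "sigma_a m n i j + sigma_b m n i j * (real i * h) = mode_flux h m i * mode h n j"
  by (simp add: affine_flux_def flip: affine_flux_coeffs)

lemma sigma_right:
  "sigma_a m n i j + sigma_b m n i j * (real (Suc i) * h) = mode_flux h m (Suc i) * mode h n j"
  by (simp only: affine_flux_coeffs[symmetric] affine_flux_Suc[OF h_pos])

lemma normal_continuous_discrete_sigma:
  "normal_continuous (sigma_a m n) (sigma_b m n) (\<lambda>i j. sigma_a n m j i) (\<lambda>i j. sigma_b n m j i)"
  unfolding normal_continuous_def sigma_left sigma_right by blast

lemma integral_const_cell: "integral (cell h i j) (\<lambda>z. c) = h\<^sup>2 * (c::real)"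
  using h_pos by (simp add: cell_def content_Pair algebra_simps power2_eq_square)

lemma discrete_u_L2: "discrete_u h m n \<in> L2_space Omega"
proof -
  have m: "(\<lambda>z. (norm (discrete_u h m n z))\<^sup>2) \<in> borel_measurable (lebesgue_on Omega)"
    by (rule borel_measurable_power[OF measurable_compose[OF
          borel_measurable_lebesgue_on[OF discrete_u_measurable] borel_measurable_norm]])
  have "integrable (lebesgue_on Omega) (\<lambda>z. (norm (discrete_u h m n z))\<^sup>2)"
  proof (rule Omega_integral_piecewise(1)[OF m])
    fix i j
    show "AE z in lebesgue_on (cell h i j). (norm (discrete_u h m n z))\<^sup>2 = (norm (mode h m i * mode h n j))\<^sup>2"
      using discrete_u_cell[of m n i j] by (rule AE_mp) simp
  qed (rule continuous_on_const)
  then show ?thesis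
    using borel_measurable_lebesgue_on[OF discrete_u_measurable] by (simp add: L2_space_def)
qed

lemma discrete_u_V_h: "discrete_u h m n \<in> V_h h"
  unfolding V_h_def mem_Collect_eq
proof (intro conjI discrete_u_L2 ballI)
  fix K assume "K \<in> uniform_mesh h"
  then obtain i j where "K = cell h i j" unfolding uniform_mesh_eq by blast
  then have "AE z in lebesgue_on K. discrete_u h m n z = mode h m i * mode h n j"
    by (simp only: discrete_u_cell)
  then show "\<exists>c. AE z in lebesgue_on K. discrete_u h m n z = c" by (rule exI)
qed

lemma discrete_sigma_L2: "discrete_sigma h m n \<in> L2_space Omega"
proof -
  let ?F = "\<lambda>i j z. (sigma_a m n i j + sigma_b m n i j * fst z, sigma_a n m j i + sigma_b n m j i * snd z)"
  have m: "(\<lambda>z. (norm (discrete_sigma h m n z))\<^sup>2) \<in> borel_measurable (lebesgue_on Omega)"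
    by (rule borel_measurable_power[OF measurable_compose[OF
          borel_measurable_lebesgue_on[OF discrete_sigma_measurable] borel_measurable_norm]])
  have "integrable (lebesgue_on Omega) (\<lambda>z. (norm (discrete_sigma h m n z))\<^sup>2)"
  proof (rule Omega_integral_piecewise(1)[OF m])
    fix i j assume ij: "i < N" "j < N"
    have "AE z in lebesgue_on (cell h i j). discrete_sigma h m n z = ?F i j z"
      using RT_coeffs_discrete_sigma ij by (simp add: RT_coeffs_def)
    then show "AE z in lebesgue_on (cell h i j). (norm (discrete_sigma h m n z))\<^sup>2 = (norm (?F i j z))\<^sup>2"
      by (rule AE_mp) simp
    show "continuous_on (cell h i j) (\<lambda>z. (norm (?F i j z))\<^sup>2)"
      by (intro continuous_intros)
  qed
  then show ?thesis
    using borel_measurable_lebesgue_on[OF discrete_sigma_measurable] by (simp add: L2_space_def)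
qed

lemma discrete_sigma_weak_divergence:
  "has_weak_divergence Omega (discrete_sigma h m n)
     (\<lambda>z. (mode_eigenvalue h m + mode_eigenvalue h n) * discrete_u h m n z)"
proof (rule normal_continuous_weak_divergence[OF
      borel_measurable_lebesgue_on[OF discrete_sigma_measurable]
      RT_coeffs_discrete_sigma normal_continuous_discrete_sigma])
  show "(\<lambda>z. (mode_eigenvalue h m + mode_eigenvalue h n) * discrete_u h m n z)
      \<in> borel_measurable (lebesgue_on Omega)"
    by (intro borel_measurable_times borel_measurable_const
        borel_measurable_lebesgue_on[OF discrete_u_measurable])
  show "AE z in lebesgue_on (cell h i j). (mode_eigenvalue h m + mode_eigenvalue h n) * discrete_u h m n z
      = sigma_b m n i j + sigma_b n m j i" for i j
    using discrete_u_cell[of m n i j] by (rule AE_mp) (simp add: sigma_b_def algebra_simps)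
qed

lemma discrete_sigma_Hdiv: "discrete_sigma h m n \<in> Hdiv Omega"
proof -
  let ?l = "mode_eigenvalue h m + mode_eigenvalue h n"
  have "(\<lambda>z. ?l * discrete_u h m n z) \<in> L2_space Omega"
    using discrete_u_L2[of m n] 
    by (simp add: L2_space_def power_mult_distrib abs_mult borel_measurable_times)
  then show ?thesis
    unfolding Hdiv_def
    by (intro CollectI conjI bexI[of _ "\<lambda>z. ?l * discrete_u h m n z"]
        discrete_sigma_weak_divergence discrete_sigma_L2)
qed

lemma discrete_sigma_Sigma_h: "discrete_sigma h m n \<in> Sigma_h h"
  unfolding Sigma_h_def mem_Collect_eq
proof (intro conjI discrete_sigma_Hdiv ballI)
  fix K assume "K \<in> uniform_mesh h"
  then obtain i j where K: "K = cell h i j" "i < N" "j < N" unfolding uniform_mesh_eq by blast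
  let ?p = "\<lambda>z. sigma_a m n i j + sigma_b m n i j * fst z"
  let ?q = "\<lambda>z. sigma_a n m j i + sigma_b n m j i * snd z"
  have "?p \<in> Q_poly 1 0"
    unfolding Q_poly_def mem_Collect_eq
    by (rule exI[of _ "\<lambda>k l. if k = 0 then sigma_a m n i j else sigma_b m n i j"]) simp
  moreover have "?q \<in> Q_poly 0 1"
    unfolding Q_poly_def mem_Collect_eq
    by (rule exI[of _ "\<lambda>k l. if l = 0 then sigma_a n m j i else sigma_b n m j i"]) simp
  moreover have "AE z in lebesgue_on K. discrete_sigma h m n z = (?p z, ?q z)"
    unfolding K(1) using RT_coeffs_discrete_sigma[of m n] K(2,3) by (simp add: RT_coeffs_def)
  ultimately show "\<exists>p\<in>Q_poly 1 0. \<exists>q\<in>Q_poly 0 1. AE z in lebesgue_on K. discrete_sigma h m n z = (p z, q z)"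
    by (intro bexI)
qed

section \<open>The two discrete equations\<close>

lemma divergence_properties:
  assumes "\<tau> \<in> Sigma_h h"
  shows "divergence Omega \<tau> \<in> L2_space Omega" "has_weak_divergence Omega \<tau> (divergence Omega \<tau>)"
    "\<tau> \<in> borel_measurable (lebesgue_on Omega)"
proof -
  have "\<tau> \<in> Hdiv Omega" using assms by (simp add: Sigma_h_def)
  then have L2: "\<tau> \<in> L2_space Omega"
    and ex: "\<exists>g. g \<in> L2_space Omega \<and> has_weak_divergence Omega \<tau> g"
    by (simp_all add: Hdiv_def Bex_def)
  show "divergence Omega \<tau> \<in> L2_space Omega" "has_weak_divergence Omega \<tau> (divergence Omega \<tau>)"
    using someI_ex[OF ex] by (simp_all add: divergence_def)
  show "\<tau> \<in> borel_measurable (lebesgue_on Omega)" using L2 by (simp add: L2_space_def)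
qed

text \<open>The representative picked by \<open>divergence\<close> disappears here: the right-hand
  side knows only the coefficients of \<open>\<tau>\<close>.\<close>

lemma L2_inner_divergence:
  assumes \<tau>: "\<tau> \<in> Sigma_h h" and rt: "RT_coeffs \<tau> a b c d"
    and v: "v \<in> borel_measurable (lebesgue_on Omega)"
    and w: "\<And>i j. i < N \<Longrightarrow> j < N \<Longrightarrow> AE z in lebesgue_on (cell h i j). v z = w i j"
  shows "L2_inner Omega (divergence Omega \<tau>) v = (\<Sum>i<N. \<Sum>j<N. w i j * ((b i j + d i j) * h\<^sup>2))"
proof -
  note D = divergence_properties[OF \<tau>]
  have "L2_inner Omega (divergence Omega \<tau>) v = (\<Sum>i<N. \<Sum>j<N.
      w i j * integral\<^sup>L (lebesgue_on (cell h i j)) (divergence Omega \<tau>))"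
    unfolding L2_inner_def inner_real_def
    by (rule integral_mult_cellwise_const[OF L2_space_integrable[OF D(1) Omega_lmeasurable] v w])
  also have "\<dots> = (\<Sum>i<N. \<Sum>j<N. w i j * ((b i j + d i j) * h\<^sup>2))"
    by (intro sum.cong refl, subst cell_integral_weak_divergence[OF D(3) rt D(1,2)]) auto
  finally show ?thesis .
qed

text \<open>The variable that a summand does not contain integrates to the edge length
  \<open>h\<close>; this decouples the flux inner product into rows and columns.\<close>

lemma integral_cell_fst_snd:
  assumes "continuous_on UNIV f" "continuous_on UNIV g"
  shows "integral (cell h i j) (\<lambda>z. f (fst z) + g (snd z)) =
    h * integral {real i * h..real (Suc i) * h} f + h * integral {real j * h..real (Suc j) * h} g"
proof -
  have c: "continuous_on UNIV (\<lambda>x::real. 1::real)" by simp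
  have len: "real (Suc k) * h - real k * h = h" for k by (simp add: algebra_simps)
  have "continuous_on S (\<lambda>z::real\<times>real. f (fst z))" "continuous_on S (\<lambda>z::real\<times>real. g (snd z))" for S
    using assms by (auto intro!: continuous_on_compose2[OF assms(1)] continuous_on_compose2[OF assms(2)]
        continuous_intros)
  then have "integral (cell h i j) (\<lambda>z. f (fst z) + g (snd z)) =
      integral (cell h i j) (\<lambda>z. f (fst z) * 1) + integral (cell h i j) (\<lambda>z. 1 * g (snd z))"
    unfolding cell_def by (simp add: integral_add integrable_continuous)
  also have "\<dots> = h * integral {real i * h..real (Suc i) * h} f + h * integral {real j * h..real (Suc j) * h} g"
    using integral_tensor_cell[OF assms(1) c, of i j] integral_tensor_cell[OF c assms(2), of i j] h_pos len
    by (simp del: of_nat_Suc)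
  finally show ?thesis .
qed

text \<open>The one-dimensional flux equation on row j. The transverse factor
  \<open>mode h n j\<close> is constant along the row and pulls out, and
  \<open>mode_row_identity\<close> turns the rest into a telescope.\<close>

lemma row_sum_zero:
  assumes "\<And>i. Suc i < N \<Longrightarrow> a i + b i * (real (Suc i) * h) = a (Suc i) + b (Suc i) * (real (Suc i) * h)"
  shows "(\<Sum>i<N. h * integral {real i * h..real (Suc i) * h} (\<lambda>x. (sigma_a m n i j + sigma_b m n i j * x) * (a i + b i * x))
     - mode h m i * mode h n j * (b i * h\<^sup>2)) = 0"
proof -
  define \<theta> where "\<theta> = real m * h"
  define \<kappa> where "\<kappa> = cos (\<theta> / 2) + sin (\<theta> / 2) * sin \<theta> / (2 + cos \<theta>)"
  let ?L = "\<lambda>i. a i + b i * (real i * h)" and ?R = "\<lambda>i. a i + b i * (real (Suc i) * h)"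
  let ?l = "\<lambda>i. - \<kappa> * h * sin (real i * \<theta>) * ?L i"
  let ?r = "\<lambda>i. - \<kappa> * h * sin (real (Suc i) * \<theta>) * ?R i"
  have row: "h * integral {real i * h..real (Suc i) * h}
        (\<lambda>x. (sigma_a m n i j + sigma_b m n i j * x) * (a i + b i * x))
      - mode h m i * mode h n j * (b i * h\<^sup>2) = mode h n j * (?r i - ?l i)" for i
  proof -
    have le: "real i * h \<le> real (Suc i) * h" using h_pos by simp
    have len: "real (Suc i) * h - real i * h = h" by (simp add: algebra_simps)
    have b: "b i * h\<^sup>2 = h * (?R i - ?L i)" by (simp add: algebra_simps power2_eq_square)
    have "h * integral {real i * h..real (Suc i) * h}
        (\<lambda>x. (sigma_a m n i j + sigma_b m n i j * x) * (a i + b i * x))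
      - mode h m i * mode h n j * (b i * h\<^sup>2) =
      mode h n j * (h\<^sup>2 / 6 * (2 * mode_flux h m i * ?L i + mode_flux h m i * ?R i
       + mode_flux h m (Suc i) * ?L i + 2 * mode_flux h m (Suc i) * ?R i) - h * (?R i - ?L i) * mode h m i)"
      unfolding integral_affine_product[OF le] sigma_left sigma_right len b
      by (simp add: algebra_simps power2_eq_square del: of_nat_Suc)
    then show ?thesis
      unfolding mode_row_identity[OF h_pos] \<kappa>_def \<theta>_def .
  qed
  have SN: "Suc (N - 1) = N" using N_pos by simp
  have "(\<Sum>i<N. ?r i - ?l i) = 0"
  proof (rule telescoping_vanishing_ends)
    \<comment> \<open>The sine at the right boundary node is sin(m pi) = 0, so the boundary trace of
      the test field is multiplied by 0.\<close>
    have "real N * \<theta> = real m * pi" by (simp add: \<theta>_def flip: N_h)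
    then have "sin (real N * \<theta>) = 0" by simp
    then show "?r (N - 1) = 0" by (simp only: SN mult_zero_right mult_zero_left)
    show "?r i = ?l (Suc i)" if "Suc i < N" for i using assms[OF that] by (simp only:)
  qed (simp_all add: N_pos)
  then show ?thesis unfolding row by (simp only: mult_zero_right flip: sum_distrib_left)
qed

text \<open>Cell by cell, the difference of both sides is a row expression in the first component
  plus a column expression in the second. Normal continuity of \<open>\<tau>\<close> makes each row
  sum and each column sum vanish.\<close>

lemma discrete_sigma_equation:
  assumes \<tau>: "\<tau> \<in> Sigma_h h"
  shows "L2_inner Omega (discrete_sigma h m n) \<tau> = L2_inner Omega (divergence Omega \<tau>) (discrete_u h m n)"
proof -
  obtain a b c d where rt: "RT_coeffs \<tau> a b c d" using Sigma_h_RT_coeffs[OF \<tau>] by blast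
  note P = divergence_properties[OF \<tau>]
  have nc: "normal_continuous a b c d"
    by (rule weak_divergence_normal_continuous[OF P(3) rt P(1,2)])
  let ?f = "\<lambda>i j x. (sigma_a m n i j + sigma_b m n i j * x) * (a i j + b i j * x)"
  let ?g = "\<lambda>i j y. (sigma_a n m j i + sigma_b n m j i * y) * (c i j + d i j * y)"
  have cf: "continuous_on UNIV (?f i j)" "continuous_on UNIV (?g i j)" for i j
    by (intro continuous_intros)+
  have lhs: "L2_inner Omega (discrete_sigma h m n) \<tau> =
      (\<Sum>i<N. \<Sum>j<N. integral (cell h i j) (\<lambda>z. ?f i j (fst z) + ?g i j (snd z)))"
    unfolding L2_inner_def
  proof (rule Omega_integral_piecewise(2))
    show "(\<lambda>z. discrete_sigma h m n z \<bullet> \<tau> z) \<in> borel_measurable (lebesgue_on Omega)"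
      by (rule borel_measurable_inner[OF borel_measurable_lebesgue_on[OF discrete_sigma_measurable] P(3)])
    fix i j assume ij: "i < N" "j < N"
    have "AE z in lebesgue_on (cell h i j). discrete_sigma h m n z =
        (sigma_a m n i j + sigma_b m n i j * fst z, sigma_a n m j i + sigma_b n m j i * snd z)"
      using RT_coeffs_discrete_sigma ij by (simp add: RT_coeffs_def)
    moreover have "AE z in lebesgue_on (cell h i j). \<tau> z = (a i j + b i j * fst z, c i j + d i j * snd z)"
      using rt ij by (simp add: RT_coeffs_def)
    ultimately show "AE z in lebesgue_on (cell h i j). discrete_sigma h m n z \<bullet> \<tau> z = ?f i j (fst z) + ?g i j (snd z)"
      by eventually_elim simp
    show "continuous_on (cell h i j) (\<lambda>z. ?f i j (fst z) + ?g i j (snd z))"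
      by (intro continuous_intros)
  qed
  have rhs: "L2_inner Omega (divergence Omega \<tau>) (discrete_u h m n) =
      (\<Sum>i<N. \<Sum>j<N. mode h m i * mode h n j * ((b i j + d i j) * h\<^sup>2))"
    by (rule L2_inner_divergence[OF \<tau> rt borel_measurable_lebesgue_on[OF discrete_u_measurable] discrete_u_cell])
  let ?X = "\<lambda>i j. h * integral {real i * h..real (Suc i) * h} (?f i j) - mode h m i * mode h n j * (b i j * h\<^sup>2)"
  \<comment> \<open>The two modes are written in exchanged order to match
    \<open>row_sum_zero\<close> with the roles of the coordinates swapped.\<close>
  let ?Y = "\<lambda>i j. h * integral {real j * h..real (Suc j) * h} (?g i j) - mode h n j * mode h m i * (d i j * h\<^sup>2)"
  have X: "(\<Sum>i<N. ?X i j) = 0" if "j < N" for j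
    by (rule row_sum_zero) (use nc that in \<open>simp only: normal_continuous_def\<close>)
  have Y: "(\<Sum>j<N. ?Y i j) = 0" if "i < N" for i
    by (rule row_sum_zero) (use nc that in \<open>simp only: normal_continuous_def\<close>)
  have "L2_inner Omega (discrete_sigma h m n) \<tau> - L2_inner Omega (divergence Omega \<tau>) (discrete_u h m n)
      = (\<Sum>i<N. \<Sum>j<N. ?X i j + ?Y i j)"
    unfolding lhs rhs integral_cell_fst_snd[OF cf] sum_subtractf[symmetric]
    by (intro sum.cong refl) (simp add: algebra_simps del: of_nat_Suc)
  also have "\<dots> = (\<Sum>j<N. \<Sum>i<N. ?X i j) + (\<Sum>i<N. \<Sum>j<N. ?Y i j)"
    unfolding sum.distrib by (simp only: sum.swap[of ?X])
  also have "\<dots> = 0"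
    using sum.neutral[of "{..<N}" "\<lambda>j. \<Sum>i<N. ?X i j"] sum.neutral[of "{..<N}" "\<lambda>i. \<Sum>j<N. ?Y i j"] X Y
    by simp
  finally show ?thesis by simp
qed

lemma discrete_u_equation:
  assumes v: "v \<in> V_h h"
  shows "L2_inner Omega (divergence Omega (discrete_sigma h m n)) v =
    (mode_eigenvalue h m + mode_eigenvalue h n) * L2_inner Omega (discrete_u h m n) v"
proof -
  define w where "w i j = (SOME c. AE z in lebesgue_on (cell h i j). v z = c)" for i j
  have w: "AE z in lebesgue_on (cell h i j). v z = w i j" if "i < N" "j < N" for i j
  proof -
    have "cell h i j \<in> uniform_mesh h"
      unfolding uniform_mesh_eq mem_Collect_eq using that
      by (intro exI[of _ i] exI[of _ j] conjI refl)
    then have "\<exists>c. AE z in lebesgue_on (cell h i j). v z = c" using v by (simp add: V_h_def)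
    then show ?thesis unfolding w_def by (rule someI_ex)
  qed
  have mv: "v \<in> borel_measurable (lebesgue_on Omega)" using v by (simp add: V_h_def L2_space_def)
  have iu: "integral\<^sup>L (lebesgue_on (cell h i j)) (discrete_u h m n) = h\<^sup>2 * (mode h m i * mode h n j)"
    if "i < N" "j < N" for i j
    using cell_integral_AE(2)[OF borel_measurable_lebesgue_on[OF discrete_u_measurable] that
        discrete_u_cell continuous_on_const]
    by (simp only: integral_const_cell)
  have "L2_inner Omega (discrete_u h m n) v =
      (\<Sum>i<N. \<Sum>j<N. w i j * integral\<^sup>L (lebesgue_on (cell h i j)) (discrete_u h m n))"
    unfolding L2_inner_def inner_real_def
    by (rule integral_mult_cellwise_const[OF L2_space_integrable[OF discrete_u_L2 Omega_lmeasurable] mv w])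
  also have "\<dots> = (\<Sum>i<N. \<Sum>j<N. w i j * (h\<^sup>2 * (mode h m i * mode h n j)))"
    using iu by (intro sum.cong refl) simp
  finally have u: "L2_inner Omega (discrete_u h m n) v = \<dots>" .
  have d: "L2_inner Omega (divergence Omega (discrete_sigma h m n)) v =
      (\<Sum>i<N. \<Sum>j<N. w i j * ((sigma_b m n i j + sigma_b n m j i) * h\<^sup>2))"
    by (rule L2_inner_divergence[OF discrete_sigma_Sigma_h RT_coeffs_discrete_sigma mv w])
  show ?thesis
    unfolding u d sum_distrib_left
    by (intro sum.cong refl) (simp add: sigma_b_def algebra_simps)
qed

text \<open>One cell suffices: p <= N gives 0 < p h / 2 < pi, so both sines are positive on the
  corner cell (0, 0).\<close>

lemma discrete_u_nonzero:
  assumes "0 < m" "m \<le> N" "0 < n" "n \<le> N"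
  shows "\<not> (AE z in lebesgue_on Omega. discrete_u h m n z = 0)"
proof
  assume "AE z in lebesgue_on Omega. discrete_u h m n z = 0"
  then have "AE z in lebesgue. z \<in> Omega \<longrightarrow> discrete_u h m n z = 0"
    using Omega_sets by (simp add: AE_restrict_space_iff)
  then have "AE z in lebesgue. z \<in> cell h 0 0 \<longrightarrow> discrete_u h m n z = 0"
    by (rule AE_mp) (use cell_subset_Omega[OF N_pos N_pos] in auto)
  then have "AE z in lebesgue_on (cell h 0 0). discrete_u h m n z = 0"
    using cell_sets[of h 0 0] by (simp add: AE_restrict_space_iff)
  from cell_integral_AE(2)[OF borel_measurable_lebesgue_on[OF discrete_u_measurable] N_pos N_pos
      this continuous_on_const]
  have "integral\<^sup>L (lebesgue_on (cell h 0 0)) (discrete_u h m n) = 0" by simp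
  moreover have "integral\<^sup>L (lebesgue_on (cell h 0 0)) (discrete_u h m n) = h\<^sup>2 * (mode h m 0 * mode h n 0)"
    using cell_integral_AE(2)[OF borel_measurable_lebesgue_on[OF discrete_u_measurable] N_pos N_pos
        discrete_u_cell continuous_on_const]
    by (simp only: integral_const_cell)
  ultimately have "mode h m 0 * mode h n 0 = 0" using h_pos by simp
  moreover have "mode h p 0 > 0" if "0 < p" "p \<le> N" for p
  proof -
    have "real p * h \<le> pi" using that by (simp add: node_le_pi_iff)
    moreover have "0 < real p * h" using that h_pos by simp
    ultimately have "0 < real p * (real 0 + 1 / 2) * h" "real p * (real 0 + 1 / 2) * h < pi"
      using pi_gt_zero by (simp_all add: field_simps)
    then show ?thesis unfolding mode_def by (rule sin_gt_zero)
  qed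
  then have "mode h m 0 * mode h n 0 > 0" using assms by (intro mult_pos_pos)
  ultimately show False by linarith
qed

lemma discrete_mixed_eigenvalue_mode:
  assumes "0 < m" "m \<le> N" "0 < n" "n \<le> N"
  shows "discrete_mixed_eigenvalue h (mode_eigenvalue h m + mode_eigenvalue h n)"
  unfolding discrete_mixed_eigenvalue_def
proof (intro bexI conjI ballI)
  show "\<not> (AE z in lebesgue_on Omega. discrete_u h m n z = 0)"
    using assms by (rule discrete_u_nonzero)
  show "L2_inner Omega (discrete_sigma h m n) \<tau> - L2_inner Omega (divergence Omega \<tau>) (discrete_u h m n) = 0"
    if "\<tau> \<in> Sigma_h h" for \<tau>
    using discrete_sigma_equation[OF that] by simp
  show "L2_inner Omega (divergence Omega (discrete_sigma h m n)) v =
      (mode_eigenvalue h m + mode_eigenvalue h n) * L2_inner Omega (discrete_u h m n) v"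
    if "v \<in> V_h h" for v
    using that by (rule discrete_u_equation)
qed (rule discrete_u_V_h discrete_sigma_Sigma_h)+

end

section \<open>Asymptotics in h and conclusion\<close>

lemma mode_eigenvalue_expansion:
  assumes "p > 0"
  shows "(\<lambda>h. mode_eigenvalue h p - real p ^ 2 - real p ^ 4 * h ^ 2 / 12) \<in> O[at_right 0](\<lambda>h. h ^ 4)"
proof -
  \<comment> \<open>With t = p h the eigenvalue is p^2 times a function of t alone, so one expansion
    free of parameters serves every frequency; rescaling by the fixed p changes only the
    constant.\<close>
  have "(\<lambda>t::real. 6 * (1 - cos t) / (t\<^sup>2 * (2 + cos t)) - 1 - t\<^sup>2 / 12)
      \<in> O[at_right 0](\<lambda>t. t ^ 4)"
    by real_asymp
  moreover have "filterlim (\<lambda>h. real p * h) (at_right 0) (at_right 0)"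
    using assms by real_asymp
  ultimately have "(\<lambda>h. 6 * (1 - cos (real p * h)) / ((real p * h)\<^sup>2 * (2 + cos (real p * h))) - 1
      - (real p * h)\<^sup>2 / 12) \<in> O[at_right 0](\<lambda>h. (real p * h) ^ 4)"
    by (rule landau_o.big.compose)
  then have "(\<lambda>h. (real p)\<^sup>2 * (6 * (1 - cos (real p * h))
      / ((real p * h)\<^sup>2 * (2 + cos (real p * h))) - 1 - (real p * h)\<^sup>2 / 12))
      \<in> O[at_right 0](\<lambda>h. h ^ 4)"
    using assms by (simp add: power_mult_distrib)
  moreover have "(real p)\<^sup>2 * (6 * (1 - cos (real p * h))
      / ((real p * h)\<^sup>2 * (2 + cos (real p * h))) - 1 - (real p * h)\<^sup>2 / 12) =
      mode_eigenvalue h p - real p ^ 2 - real p ^ 4 * h ^ 2 / 12" for h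
  proof -
    have "(real p)\<^sup>2 * (6 * (1 - cos (real p * h)) / ((real p * h)\<^sup>2 * (2 + cos (real p * h))))
        = mode_eigenvalue h p"
      using assms by (simp add: mode_eigenvalue_def power_mult_distrib)
    moreover have "(real p)\<^sup>2 * ((real p * h)\<^sup>2 / 12) = real p ^ 4 * h ^ 2 / 12"
      by (simp add: power2_eq_square power4_eq_xxxx)
    ultimately show ?thesis by (simp only: right_diff_distrib mult_1_right)
  qed
  ultimately show ?thesis by (simp only:)
qed

theorem theorem8:
  fixes m n :: nat and lam :: real
  assumes "m > 0" and "n > 0"
    and "lam = real m ^ 2 + real n ^ 2"
    and "dirichlet_eigenvalue Omega lam"
  shows "\<exists>lam_h :: real \<Rightarrow> real.
    (\<forall>h\<in>mesh_sizes. discrete_mixed_eigenvalue h (lam_h h)) \<and>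
    (\<lambda>h. (lam_h h - lam) - (real m ^ 4 + real n ^ 4) * h ^ 2 / 12)
      \<in> O[at 0 within mesh_sizes](\<lambda>h. h ^ 4)"
proof -
  let ?fine = "\<lambda>h. real m * h \<le> pi \<and> real n * h \<le> pi"
  \<comment> \<open>Meshes too coarse to resolve the mode \<open>(m, n)\<close> do not matter for the limit; they get the mode \<open>(1, 1)\<close>.\<close>
  define lam_h where "lam_h h = (if ?fine h then mode_eigenvalue h m + mode_eigenvalue h n
    else mode_eigenvalue h 1 + mode_eigenvalue h 1)" for h
  show ?thesis
  proof (intro exI[of _ lam_h] conjI ballI)
    fix h assume "h \<in> mesh_sizes"
    then have h: "h > 0" and "\<exists>N. real N * h = pi" by (simp_all add: mesh_sizes_def)
    then obtain N where N: "real N * h = pi" by (elim exE)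
    interpret mesh N h using h N by (rule mesh.intro)
    show "discrete_mixed_eigenvalue h (lam_h h)"
    proof (cases "?fine h")
      case True
      then have "m \<le> N" "n \<le> N" by (simp_all only: node_le_pi_iff)
      with assms(1,2) have "discrete_mixed_eigenvalue h (mode_eigenvalue h m + mode_eigenvalue h n)"
        by (intro discrete_mixed_eigenvalue_mode)
      then show ?thesis unfolding lam_h_def if_P[OF True] .
    next
      case False
      have "discrete_mixed_eigenvalue h (mode_eigenvalue h 1 + mode_eigenvalue h 1)"
        using N_pos by (intro discrete_mixed_eigenvalue_mode) simp_all
      then show ?thesis unfolding lam_h_def if_not_P[OF False] .
    qed
  next
    let ?r = "\<lambda>p h. mode_eigenvalue h p - real p ^ 2 - real p ^ 4 * h ^ 2 / 12"
    \<comment> \<open>Mesh sizes are positive, so the estimate along all h tending to 0 from the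
      right restricts to them.\<close>
    have le: "at 0 within mesh_sizes \<le> at_right (0::real)"
      by (rule at_le) (auto simp: mesh_sizes_def)
    have big: "(\<lambda>h. ?r m h + ?r n h) \<in> O[at_right 0](\<lambda>h. h ^ 4)"
      by (intro sum_in_bigo mode_eigenvalue_expansion assms)
    have ev: "\<forall>\<^sub>F h in at_right 0.
        ?r m h + ?r n h = (lam_h h - lam) - (real m ^ 4 + real n ^ 4) * h ^ 2 / 12"
    proof -
      have "\<forall>\<^sub>F h in at_right 0. real p * h < pi" for p
      proof (rule order_tendstoD)
        show "((\<lambda>h. real p * h) \<longlongrightarrow> real p * 0) (at_right 0)" by (intro tendsto_intros)
      qed simp
      from this[of m] this[of n] show ?thesis
        by eventually_elim (simp add: lam_h_def assms(3) field_simps)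
    qed
    from landau_o.big.in_cong[OF ev] big
    have "(\<lambda>h. (lam_h h - lam) - (real m ^ 4 + real n ^ 4) * h ^ 2 / 12)
        \<in> O[at_right 0](\<lambda>h. h ^ 4)"
      by (rule iffD1)
    then show "(\<lambda>h. (lam_h h - lam) - (real m ^ 4 + real n ^ 4) * h ^ 2 / 12)
        \<in> O[at 0 within mesh_sizes](\<lambda>h. h ^ 4)"
      by (rule landau_o.big.filter_mono[OF le])
  qed
qed

end
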